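(* Let $q$ be even, let $h_1$ be a polynomial over $GF(q)$, let $C\in GF(q)$, and let $\sigma$ be an automorphism of $GF(q)$. Put $g(x,y)=h_1(x)+Cy^{\sigma}$. If the set of lines $$\mathcal S_g = \langle (0,0,0,1),(0,0,1,0)\rangle \cup \{ \langle (0,1,x,y), (1,0,-y,g(x,y)) \rangle \ | \ x,y \in GF(q) \}$$ is a (symplectic) spread of $PG(3,q)$, then $\mathcal S_g$ is either a regular spread or a Tits–Lüneburg spread.
   Context: $PG(3,q)$ is the projective space of dimension 3 over $GF(q)$; $\langle u,v\rangle$ denotes the line through points $u,v$. A spread is a set of lines partitioning the points of $PG(3,q)$; it is symplectic if its lines are totally isotropic for a fixed non-degenerate alternating form, here $((x_0,x_1,x_2,x_3),(y_0,y_1,y_2,y_3))=x_0y_3-x_3y_0-x_1y_2+y_1x_2$ (the lines of $\mathcal S_g$ are automatically totally isotropic). A regular spread is one that contains, along with any three of its lines, all lines of the regulus they determine; for $q$ even it is (up to equivalence) $\mathcal S_g$ with $g(x,y)=cx+y$ where $\mathrm{Tr}_{GF(q)\to GF(2)}(c)=1$. For $q=2^{2h+1}$ and $\alpha=\sqrt{2q}=2^{h+1}$, a Tits–Lüneburg spread is a spread equivalent (under a collineation of $PG(3,q)$) to $\mathcal S_g$ with $g(x,y)=x^{\alpha+1}+y^{\alpha}$. *)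

theory Defs
  imports
    "HOL-Analysis.Cartesian_Space"
    "HOL-Computational_Algebra.Polynomial"
    "HOL-Library.Disjoint_Sets"
begin

text \<open>
  Points are one-dimensional subspaces of the coordinate space (as sets of vectors), and lines are
  sets of points. Coordinates \<open>x\<^sub>0, x\<^sub>1, x\<^sub>2, x\<^sub>3\<close> are the components \<open>1, 2, 3, 4\<close> of the library's
  vectors.
\<close>

definition pg_points :: "('a::field ^ 4) set set" where
  "pg_points = {P. vec.subspace P \<and> vec.dim P = 1}"

definition pg_flat :: "('a::field ^ 4) set \<Rightarrow> ('a ^ 4) set set" where
  "pg_flat U = {P \<in> pg_points. P \<subseteq> U}"

definition pg_lines :: "('a::field ^ 4) set set set" where
  "pg_lines = {pg_flat U |U. vec.subspace U \<and> vec.dim U = 2}"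

definition line_through :: "'a::field ^ 4 \<Rightarrow> 'a ^ 4 \<Rightarrow> ('a ^ 4) set set" where
  "line_through u v = pg_flat (vec.span {u, v})"

definition spread :: "('a::field ^ 4) set set set \<Rightarrow> bool" where
  "spread S \<longleftrightarrow> S \<subseteq> pg_lines \<and> partition_on pg_points S"

definition alt_form :: "'a::field ^ 4 \<Rightarrow> 'a ^ 4 \<Rightarrow> 'a" where
  "alt_form x y = x$1 * y$4 - x$4 * y$1 - x$2 * y$3 + y$2 * x$3"

definition totally_isotropic :: "('a::field ^ 4) set set \<Rightarrow> bool" where
  "totally_isotropic l \<longleftrightarrow> (\<forall>P\<in>l. \<forall>Q\<in>l. \<forall>u\<in>P. \<forall>v\<in>Q. alt_form u v = 0)"

definition symplectic_spread :: "('a::field ^ 4) set set set \<Rightarrow> bool" where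
  "symplectic_spread S \<longleftrightarrow> spread S \<and> (\<forall>l\<in>S. totally_isotropic l)"

definition transversals ::
  "('a::field ^ 4) set set \<Rightarrow> ('a ^ 4) set set \<Rightarrow> ('a ^ 4) set set \<Rightarrow> ('a ^ 4) set set set" where
  "transversals l m n = {t \<in> pg_lines. t \<inter> l \<noteq> {} \<and> t \<inter> m \<noteq> {} \<and> t \<inter> n \<noteq> {}}"

text \<open>The regulus of three lines is only meaningful when these are pairwise skew.\<close>

definition regulus ::
  "('a::field ^ 4) set set \<Rightarrow> ('a ^ 4) set set \<Rightarrow> ('a ^ 4) set set \<Rightarrow> ('a ^ 4) set set set" where
  "regulus l m n = {k \<in> pg_lines. \<forall>t \<in> transversals l m n. k \<inter> t \<noteq> {}}"

definition regular_spread :: "('a::field ^ 4) set set set \<Rightarrow> bool" where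
  "regular_spread S \<longleftrightarrow> spread S \<and>
     (\<forall>l\<in>S. \<forall>m\<in>S. \<forall>n\<in>S. l \<noteq> m \<and> l \<noteq> n \<and> m \<noteq> n \<longrightarrow> regulus l m n \<subseteq> S)"

definition collineation :: "(('a::field ^ 4) set \<Rightarrow> ('a ^ 4) set) \<Rightarrow> bool" where
  "collineation f \<longleftrightarrow> bij_betw f pg_points pg_points \<and>
     (\<forall>l. l \<subseteq> pg_points \<longrightarrow> (f ` l \<in> pg_lines \<longleftrightarrow> l \<in> pg_lines))"

definition equivalent_sets :: "('a::field ^ 4) set set set \<Rightarrow> ('a ^ 4) set set set \<Rightarrow> bool" where
  "equivalent_sets S T \<longleftrightarrow> (\<exists>f. collineation f \<and> S = (\<lambda>l. f ` l) ` T)"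

definition spread_of :: "('a::field \<Rightarrow> 'a \<Rightarrow> 'a) \<Rightarrow> ('a ^ 4) set set set" where
  "spread_of g = {line_through (vector [0, 0, 0, 1]) (vector [0, 0, 1, 0])} \<union>
     {line_through (vector [0, 1, x, y]) (vector [1, 0, - y, g x y]) |x y. True}"

definition tits_lueneburg_spread :: "('a::{field,finite} ^ 4) set set set \<Rightarrow> bool" where
  "tits_lueneburg_spread S \<longleftrightarrow> spread S \<and>
     (\<exists>h::nat. CARD('a) = 2 ^ (2 * h + 1) \<and>
        equivalent_sets S (spread_of (\<lambda>x y. x ^ (2 ^ (h + 1) + 1) + y ^ (2 ^ (h + 1)))))"

definition field_automorphism :: "('a::field \<Rightarrow> 'a) \<Rightarrow> bool" where
  "field_automorphism \<sigma> \<longleftrightarrow> bij \<sigma> \<and>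
     (\<forall>x y. \<sigma> (x + y) = \<sigma> x + \<sigma> y) \<and> (\<forall>x y. \<sigma> (x * y) = \<sigma> x * \<sigma> y) \<and> \<sigma> 1 = 1"

lemma vector_4_nth [simp]:
  "(vector [a, b, c, d] :: 'a::zero ^ 4) $ 1 = a"
  "(vector [a, b, c, d] :: 'a::zero ^ 4) $ 2 = b"
  "(vector [a, b, c, d] :: 'a::zero ^ 4) $ 3 = c"
  "(vector [a, b, c, d] :: 'a::zero ^ 4) $ 4 = d"
  by (simp_all add: vector_def)

lemma totally_isotropic_line_through:
  assumes "alt_form u v = 0"
  shows "totally_isotropic (line_through u v)"
proof -
  have "alt_form x y = 0" if xy: "x \<in> vec.span {u, v}" "y \<in> vec.span {u, v}" for x y
  proof -
    have ex: "\<exists>a b. w = a *s u + b *s v" if "w \<in> vec.span {u, v}" for w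
    proof -
      from that obtain a where "w - a *s u \<in> vec.span {v}"
        by (auto simp: vec.span_insert)
      then obtain b where "w - a *s u = b *s v"
        by (auto simp: vec.span_singleton)
      then show ?thesis by (auto simp: diff_eq_eq add.commute)
    qed
    obtain a b c d where "x = a *s u + b *s v" "y = c *s u + d *s v"
      using ex[OF xy(1)] ex[OF xy(2)] by auto
    then have "alt_form x y = (a * d - b * c) * alt_form u v"
      by (simp add: alt_form_def algebra_simps)
    then show ?thesis using assms by simp
  qed
  then show ?thesis
    unfolding totally_isotropic_def line_through_def pg_flat_def by blast
qed

text \<open>The word \<^emph>\<open>symplectic\<close> adds nothing to \<^emph>\<open>spread\<close> for the sets \<open>spread_of g\<close>.\<close>

lemma symplectic_spread_of_iff: "symplectic_spread (spread_of g) \<longleftrightarrow> spread (spread_of g)"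
proof -
  have "totally_isotropic l" if "l \<in> spread_of g" for l
    using that unfolding spread_of_def
    by (auto intro!: totally_isotropic_line_through simp: alt_form_def)
  then show ?thesis by (auto simp: symplectic_spread_def)
qed

end

theory Submission
  imports Defs "HOL-Library.Multiset"
begin

text \<open>
  Two lines of \<open>\<S>\<^sub>g\<close> are skew if and only if \<open>(x + z) (g(x, y) + g(z, w)) + (y + w)\<^sup>2 \<noteq> 0\<close>. Write \<open>\<sigma>(x) = \<tau>(x)\<^sup>2\<close> and
  \<open>h\<^sub>1(x) = C H(Cx)\<close>. The condition forces the fixed field of \<open>\<tau>\<close> to be \<open>GF(2)\<close>, and by additive Hilbert 90 it then reads
  \<open>Tr (\<tau>(d) (H(X + u) + H(X))) = 1\<close> with \<open>u = \<tau>(d) / d\<close>, for all \<open>X\<close> and all \<open>d \<noteq> 0\<close>.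
  Differentiating this relation shows that the top derivatives of \<open>H\<close> are biadditive maps \<open>B\<close> with
  \<open>Tr (\<tau>(d) B(u, v)) = 0\<close>. Comparing exponents of \<open>d\<close>, which are sums of three powers of \<open>2\<close> modulo \<open>q - 1\<close>,
  leaves only \<open>B(u, v) = a(v) u + \<tau>(a(v)) u\<^sup>\<sigma>\<close>, and since \<open>B\<close> is alternating, either \<open>B = 0\<close>, or
  \<open>\<sigma>\<tau> = 1\<close> and \<open>B(u, v) = u v\<^sup>\<sigma> + u\<^sup>\<sigma> v\<close>. In the first case \<open>H\<close> is affine over \<open>GF(q)\<close> and \<open>\<sigma> = 1\<close>; in the second
  \<open>H(X) = X\<^bsup>\<sigma> + 1\<^esup> + aX + \<tau>(a) X\<^sup>\<sigma> + b\<close>, which is equivalent to the Tits--Lueneburg function.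
  The exponent comparison fails for \<open>\<tau>(x) = x\<^sup>2\<close>, which is treated by differentiating a cubic form.
\<close>

section \<open>Fields of even order\<close>

text \<open>The trace enters by scaling. With \<open>u = \<tau>(d) / d\<close>,
  \<open>D = H(X + u) + H(X)\<close> and \<open>y = d v\<^sup>2\<close>, multiplying
  \<open>u (D + \<sigma>(v)) + v\<^sup>2\<close> by \<open>d\<close> gives
  \<open>\<tau>(d) D + \<tau>(y) + y\<close>, so two lines meet exactly if an equation of
  Artin--Schreier type is solvable for \<open>y\<close>. As \<open>h1\<close> is arbitrary, nothing
  bounds its degree in advance. Differences in \<open>X\<close> lower the degree and preserve a
  trace identity for each fixed \<open>d\<close>. The remaining \<open>u \<mapsto> B(u, v)\<close>
  is additive, hence a linearized polynomial, and \<open>d\<close> becomes the only variable whose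
  powers have to be compared. For \<open>\<tau>(x) = x\<^sup>2\<close> the expression
  \<open>\<tau>(d) L(\<tau>(d) / d)\<close> is just \<open>d\<^sup>2 L(d)\<close>; its trace
  vanishes whenever the bilinear form \<open>Tr (x\<^sup>2 L(y))\<close> is alternating, which
  allows many \<open>L\<close>. All three arguments of the cubic form are needed there.\<close>

text \<open>If \<open>2\<close> were nonzero, negation would pair off the nonzero elements without
  fixed points, and the field would have odd order.\<close>

lemma two_eq_0_if_even_card:
  assumes "even CARD('a::{field,finite})"
  shows "(2::'a) = 0"
proof (rule ccontr)
  assume 2: "(2::'a) \<noteq> 0"
  have neq: "x \<noteq> - x" if "x \<noteq> 0" for x :: 'a
  proof
    assume "x = - x"
    then have "2 * x = 0" by (metis add.right_inverse mult_2)
    with 2 that show False by simp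
  qed
  have "even (card (UNIV - {0::'a}))"
  proof -
    have "partition_on (UNIV - {0::'a}) ((\<lambda>x. {x, - x}) ` (UNIV - {0}))"
      unfolding partition_on_def disjoint_def by fastforce
    then have "card (UNIV - {0::'a}) = (\<Sum>p\<in>(\<lambda>x. {x, - x}) ` (UNIV - {0::'a}). card p)"
      by (intro product_partition) auto
    also have "\<dots> = (\<Sum>p\<in>(\<lambda>x. {x, - x}) ` (UNIV - {0::'a}). 2)"
    proof (intro sum.cong refl)
      fix p assume "p \<in> (\<lambda>x. {x, - x}) ` (UNIV - {0::'a})"
      then obtain x :: 'a where "x \<noteq> 0" "p = {x, - x}" by blast
      with neq show "card p = 2" by (metis card_2_iff)
    qed
    finally show ?thesis by simp
  qed
  moreover have "CARD('a) = Suc (card (UNIV - {0::'a}))"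
    by (rule card_Suc_Diff1[symmetric]) auto
  ultimately show False using assms by (metis even_Suc)
qed

lemma power_card_minus_1:
  fixes x :: "'a::{field,finite}"
  assumes "x \<noteq> 0"
  shows "x ^ (CARD('a) - 1) = 1"
proof -
  have "(\<Prod>y\<in>UNIV - {0}. y) = (\<Prod>y\<in>UNIV - {0}. x * y)"
    by (rule prod.reindex_bij_witness[of _ "\<lambda>y. x * y" "\<lambda>y. y / x"]) (use assms in auto)
  also have "\<dots> = x ^ (CARD('a) - 1) * (\<Prod>y\<in>UNIV - {0}. y)"
    by (simp add: prod.distrib card_Diff_subset)
  finally show ?thesis by simp
qed

lemma power_card:
  fixes x :: "'a::{field,finite}"
  shows "x ^ CARD('a) = x"
proof (cases "x = 0")
  case False
  have "x ^ CARD('a) = x * x ^ (CARD('a) - 1)" by (simp flip: power_Suc)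
  then show ?thesis using power_card_minus_1[OF False] by simp
qed (simp add: power_0_left)

definition additive_map :: "('a::ab_group_add \<Rightarrow> 'a) \<Rightarrow> bool" where
  "additive_map L \<longleftrightarrow> (\<forall>x y. L (x + y) = L x + L y)"

lemma additive_mapD: "additive_map L \<Longrightarrow> L (x + y) = L x + L y"
  by (simp add: additive_map_def)

lemma additive_0: "additive_map L \<Longrightarrow> L 0 = 0"
  by (metis add.right_neutral add_left_cancel additive_mapD)

lemma additive_sum: "additive_map L \<Longrightarrow> L (sum f A) = (\<Sum>x\<in>A. L (f x))"
  by (induction A rule: infinite_finite_induct) (auto simp: additive_0 additive_mapD)

locale char_2 =
  fixes ty :: "'a::{field,finite} itself"
  assumes two: "(2::'a) = 0"
begin

lemma add_self [simp]: "x + x = (0::'a)"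
  by (metis two mult_2 mult_zero_left)

lemma add_self_left [simp]: "x + (x + y) = (y::'a)"
  by (simp flip: add.assoc)

lemma minus_eq [simp]: "- x = (x::'a)"
  by (metis add_self minus_unique)

lemma diff_eq [simp]: "x - y = x + (y::'a)"
  by (metis add_uminus_conv_diff minus_eq)

lemma add_eq_0: "x + y = 0 \<longleftrightarrow> x = (y::'a)"
  by (metis add_self add_left_cancel)

lemma add_square: "(x + y)\<^sup>2 = x\<^sup>2 + (y::'a)\<^sup>2"
  by (simp add: power2_sum two)

lemma power2_commute_frob: "((x::'a)\<^sup>2) ^ 2 ^ k = (x ^ 2 ^ k)\<^sup>2"
  by (metis mult.commute power_mult)

lemma frob_add: "(x + y) ^ 2 ^ k = x ^ 2 ^ k + (y::'a) ^ 2 ^ k"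
  by (induction k) (simp_all add: power_mult power2_commute_frob flip: add_square)

lemma additive_frob: "additive_map (\<lambda>x. c * (x::'a) ^ 2 ^ k)"
  by (simp add: additive_map_def frob_add algebra_simps)

lemma sum_frob: "(sum f A) ^ 2 ^ k = (\<Sum>x\<in>A. (f x :: 'a) ^ 2 ^ k)"
  using additive_sum[OF additive_frob[of 1 k]] by simp

lemma frob_inj: "x ^ 2 ^ k = y ^ 2 ^ k \<longleftrightarrow> x = (y::'a)"
proof
  assume "x ^ 2 ^ k = y ^ 2 ^ k"
  then have "(x + y) ^ 2 ^ k = 0" by (simp add: frob_add)
  then show "x = y" by (simp add: add_eq_0)
qed simp

lemma frob_surj: "\<exists>y. y ^ 2 ^ k = (x::'a)"
proof -
  have "inj (\<lambda>y::'a. y ^ 2 ^ k)" by (simp add: inj_def frob_inj)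
  then have "surj (\<lambda>y::'a. y ^ 2 ^ k)" by (rule finite_UNIV_inj_surj[OF finite])
  then show ?thesis by (metis surjD)
qed

text \<open>A subgroup of order \<open>2\<^sup>k\<close> is the zero set of a linearized polynomial \<open>N\<close> of degree \<open>2\<^sup>k\<close>:
  adjoining \<open>x\<close> replaces \<open>N\<close> by \<open>N\<^sup>2 + N(x) N\<close>. An additive map that has been interpolated on the subgroup
  is interpolated on the larger one by adding a multiple of \<open>N\<close>.\<close>

definition interpolating_subgroup :: "nat \<Rightarrow> 'a set \<Rightarrow> bool" where
  "interpolating_subgroup k V \<longleftrightarrow> 0 \<in> V \<and> (\<forall>x\<in>V. \<forall>y\<in>V. x + y \<in> V) \<and> card V = 2 ^ k \<and>
     (\<exists>n. \<forall>u. u \<in> V \<longleftrightarrow> (\<Sum>p\<le>k. n p * u ^ 2 ^ p) = 0) \<and>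
     (\<forall>L. additive_map L \<longrightarrow> (\<exists>l. \<forall>u\<in>V. L u = (\<Sum>p<k. l p * u ^ 2 ^ p)))"

lemma interpolating_subgroup_0: "interpolating_subgroup 0 {0}"
  unfolding interpolating_subgroup_def by (auto intro!: exI[of _ "\<lambda>_. 1"] simp: additive_0)

lemma interpolating_subgroup_Suc:
  assumes V: "interpolating_subgroup k V" and x: "x \<notin> V"
  shows "interpolating_subgroup (Suc k) (V \<union> (+) x ` V)"
proof -
  have V0: "0 \<in> V" and Vadd: "\<And>u v. u \<in> V \<Longrightarrow> v \<in> V \<Longrightarrow> u + v \<in> V" and cV: "card V = 2 ^ k"
    using V by (auto simp: interpolating_subgroup_def)
  obtain n where n: "\<And>u. u \<in> V \<longleftrightarrow> (\<Sum>p\<le>k. n p * u ^ 2 ^ p) = 0"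
    using V by (auto simp: interpolating_subgroup_def)
  define N where "N u = (\<Sum>p\<le>k. n p * u ^ 2 ^ p)" for u
  have N0: "N u = 0 \<longleftrightarrow> u \<in> V" for u using n by (simp add: N_def)
  have Nadd: "N (u + v) = N u + N v" for u v
    by (simp add: N_def frob_add sum.distrib algebra_simps)
  have mem: "u \<in> V \<union> (+) x ` V \<longleftrightarrow> N u = 0 \<or> N u = N x" for u
  proof -
    have "u \<in> (+) x ` V \<longleftrightarrow> x + u \<in> V"
      by (auto simp: image_iff) (metis add_self_left)
    also have "\<dots> \<longleftrightarrow> N u = N x" using N0[of "x + u"] by (auto simp: Nadd add_eq_0)
    finally show ?thesis using N0 by auto
  qed
  have "u + v \<in> V \<union> (+) x ` V" if "u \<in> V \<union> (+) x ` V" "v \<in> V \<union> (+) x ` V" for u v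
    using that unfolding mem by (auto simp: Nadd)
  moreover have "card (V \<union> (+) x ` V) = 2 ^ Suc k"
  proof -
    have "V \<inter> (+) x ` V = {}"
    proof (rule ccontr)
      assume "V \<inter> (+) x ` V \<noteq> {}"
      then obtain u where "u \<in> V" "x + u \<in> V" by auto
      then have "(x + u) + u \<in> V" using Vadd by blast
      with x show False by (simp add: add.assoc)
    qed
    then show ?thesis using cV by (simp add: card_Un_disjoint card_image)
  qed
  moreover have "\<exists>n. \<forall>u. u \<in> V \<union> (+) x ` V \<longleftrightarrow> (\<Sum>p\<le>Suc k. n p * u ^ 2 ^ p) = 0"
  proof -
    \<comment> \<open>Squaring moves the coefficient of \<open>u ^ 2 ^ (p - 1)\<close> to
      \<open>u ^ 2 ^ p\<close>, hence the shifted first summand.\<close>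
    define n' where "n' p = (if p = 0 then 0 else (n (p - 1))\<^sup>2) + (if p \<le> k then N x * n p else 0)" for p
    have "(\<Sum>p\<le>Suc k. n' p * u ^ 2 ^ p) = N u * (N u + N x)" for u
    proof -
      have "(\<Sum>p\<le>Suc k. n' p * u ^ 2 ^ p) =
          (\<Sum>p\<le>Suc k. (if p = 0 then 0 else (n (p - 1))\<^sup>2) * u ^ 2 ^ p) + (\<Sum>p\<le>Suc k. (if p \<le> k then N x * n p else 0) * u ^ 2 ^ p)"
        by (simp only: n'_def distrib_right sum.distrib)
      also have "(\<Sum>p\<le>Suc k. (if p = 0 then 0 else (n (p - 1))\<^sup>2) * u ^ 2 ^ p) = (\<Sum>p\<le>k. (n p)\<^sup>2 * u ^ 2 ^ Suc p)"
        by (simp only: sum.atMost_Suc_shift) simp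
      also have "\<dots> = (N u)\<^sup>2"
        unfolding N_def sum_frob[of _ _ 1, simplified]
        by (simp add: power_mult_distrib power_mult power2_commute_frob)
      also have "(\<Sum>p\<le>Suc k. (if p \<le> k then N x * n p else 0) * u ^ 2 ^ p) = N x * N u"
        by (simp add: N_def sum_distrib_left mult.assoc)
      finally show ?thesis by (simp add: power2_eq_square algebra_simps)
    qed
    then have "\<forall>u. u \<in> V \<union> (+) x ` V \<longleftrightarrow> (\<Sum>p\<le>Suc k. n' p * u ^ 2 ^ p) = 0"
      unfolding mem by (auto simp: add_eq_0)
    then show ?thesis by blast
  qed
  moreover have "\<exists>l. \<forall>u\<in>V \<union> (+) x ` V. L u = (\<Sum>p<Suc k. l p * u ^ 2 ^ p)" if L: "additive_map L" for L
  proof -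
    obtain l where l: "\<And>u. u \<in> V \<Longrightarrow> L u = (\<Sum>p<k. l p * u ^ 2 ^ p)"
      using V L by (auto simp: interpolating_subgroup_def)
    define A where "A u = (\<Sum>p<k. l p * u ^ 2 ^ p)" for u
    have Aadd: "A (u + v) = A u + A v" for u v
      by (simp add: A_def frob_add sum.distrib algebra_simps)
    \<comment> \<open>\<open>N\<close> vanishes on \<open>V\<close> but not at \<open>x\<close>, so
      adding \<open>c * N\<close> corrects the value at \<open>x\<close> without disturbing
      \<open>V\<close>.\<close>
    define c where "c = (L x + A x) / N x"
    define l' where "l' p = (if p < k then l p else 0) + c * n p" for p
    have l': "(\<Sum>p<Suc k. l' p * u ^ 2 ^ p) = A u + c * N u" for u
    proof -
      have "(\<Sum>p<Suc k. l' p * u ^ 2 ^ p) =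
          (\<Sum>p<Suc k. (if p < k then l p else 0) * u ^ 2 ^ p) + (\<Sum>p<Suc k. c * n p * u ^ 2 ^ p)"
        by (simp only: l'_def distrib_right sum.distrib)
      then show ?thesis
        by (simp add: A_def N_def sum_distrib_left mult.assoc distrib_left lessThan_Suc_atMost[symmetric])
    qed
    have "N x \<noteq> 0" using x N0 by simp
    then have cN: "c * N x = L x + A x" by (simp add: c_def)
    have "L u = A u + c * N u" if "u \<in> V" for u
      using that l N0[of u] by (simp add: A_def)
    moreover from this have "L (x + u) = A (x + u) + c * N (x + u)" if "u \<in> V" for u
      using that by (simp add: additive_mapD[OF L] Aadd Nadd distrib_left cN ac_simps)
    ultimately show ?thesis
      using l' by (intro exI[of _ l']) auto
  qed
  ultimately show ?thesis
    using V0 unfolding interpolating_subgroup_def by blast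
qed

text \<open>A subgroup of maximal order cannot miss an element, since it could be enlarged. This
  yields at once that the order of the field is a power of two and that all additive maps are
  linearized polynomials.\<close>

lemma ex_interpolating_UNIV: "\<exists>e. interpolating_subgroup e UNIV"
proof -
  define K where "K = {k. \<exists>V. interpolating_subgroup k V}"
  have "K \<subseteq> {..CARD('a)}"
  proof
    fix k assume "k \<in> K"
    then obtain V :: "'a set" where "card V = 2 ^ k" by (auto simp: K_def interpolating_subgroup_def)
    then have "2 ^ k \<le> CARD('a)" by (metis card_mono finite subset_UNIV)
    then show "k \<in> {..CARD('a)}"
      by (metis atMost_iff less_exp less_imp_le_nat order.trans)
  qed
  then have fin: "finite K" using finite_subset by blast
  moreover have "K \<noteq> {}" using interpolating_subgroup_0 by (auto simp: K_def)
  ultimately have "Max K \<in> K" by simp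
  then obtain V where V: "interpolating_subgroup (Max K) V" by (auto simp: K_def)
  have "V = UNIV"
  proof (rule ccontr)
    assume "V \<noteq> UNIV"
    then obtain x where "x \<notin> V" by blast
    from interpolating_subgroup_Suc[OF V this] have "Suc (Max K) \<in> K" by (auto simp: K_def)
    from Max_ge[OF fin this] show False by simp
  qed
  with V show ?thesis by blast
qed

end

section \<open>Linearized polynomials, automorphisms and the trace\<close>

locale field_2e = char_2 ty for ty :: "'a::{field,finite} itself" +
  fixes e :: nat
  assumes card: "CARD('a) = 2 ^ e"
begin

lemma e_pos: "0 < e"
proof (rule ccontr)
  assume "\<not> 0 < e"
  then have "card (UNIV :: 'a set) \<le> Suc 0" using card by simp
  then have "(0::'a) = 1" by (meson UNIV_I card_le_Suc0_iff_eq finite)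
  then show False by simp
qed

lemma power_order: "x \<noteq> 0 \<Longrightarrow> (x::'a) ^ (2 ^ e - 1) = 1"
  using power_card_minus_1[of x] by (simp add: card)

lemma frob_e: "(x::'a) ^ 2 ^ e = x"
  using power_card[of x] by (simp add: card)

lemma frob_mod: "(x::'a) ^ 2 ^ (k mod e) = x ^ 2 ^ k"
proof -
  have "x ^ 2 ^ (e * m) = x" for m
    by (induction m) (simp_all add: power_add power_mult frob_e)
  then have "(x ^ 2 ^ (e * (k div e))) ^ 2 ^ (k mod e) = x ^ 2 ^ (k mod e)" by metis
  then have "x ^ 2 ^ (e * (k div e) + k mod e) = x ^ 2 ^ (k mod e)"
    by (simp only: power_add power_mult)
  then show ?thesis by simp
qed

lemma linearized:
  assumes "additive_map L"
  obtains l where "\<And>u::'a. L u = (\<Sum>p<e. l p * u ^ 2 ^ p)"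
proof -
  obtain k where k: "interpolating_subgroup k (UNIV :: 'a set)" using ex_interpolating_UNIV by blast
  then have "k = e" using card by (simp add: interpolating_subgroup_def)
  with k assms that show thesis by (auto simp: interpolating_subgroup_def)
qed

text \<open>The polynomial has degree at most \<open>2 ^ (e - 1)\<close>, too small for
  \<open>2 ^ e\<close> roots unless it is zero.\<close>

lemma linearized_unique:
  assumes "\<And>u::'a. (\<Sum>p<e. l p * u ^ 2 ^ p) = 0" and "p < e"
  shows "l p = 0"
proof -
  define P where "P = (\<Sum>p<e. monom (l p) (2 ^ p))"
  have "poly P u = 0" for u
    using assms(1) by (simp add: P_def poly_sum poly_monom)
  moreover have "degree P \<le> 2 ^ (e - 1)"
    unfolding P_def by (rule degree_sum_le) (auto intro!: order_trans[OF degree_monom_le])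
  moreover have "2 ^ (e - 1) < (2 ^ e :: nat)" using e_pos by simp
  ultimately have "P = 0"
    using card_poly_roots_bound[of P] card by (metis (mono_tags, lifting) UNIV_eq_I linorder_not_less mem_Collect_eq order_trans)
  then have "coeff P (2 ^ p) = 0" by simp
  then show ?thesis using assms(2) by (simp add: P_def coeff_sum)
qed

text \<open>A form of Dedekind's independence argument: comparing the coefficients of
  \<open>u\<close> in \<open>\<sigma> (u * y) = \<sigma> u * \<sigma> y\<close> shows that
  \<open>\<sigma>\<close> is the \<open>2 ^ p\<close>-th power for each \<open>p\<close> that occurs
  in its linearized form.\<close>

lemma field_automorphism_frob:
  assumes "field_automorphism (\<sigma> :: 'a \<Rightarrow> 'a)"
  obtains s where "s < e" "\<And>x. \<sigma> x = x ^ 2 ^ s"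
proof -
  have add: "\<And>x y. \<sigma> (x + y) = \<sigma> x + \<sigma> y" and mult: "\<And>x y. \<sigma> (x * y) = \<sigma> x * \<sigma> y" and one: "\<sigma> 1 = 1"
    using assms by (auto simp: field_automorphism_def)
  obtain l where l: "\<And>u. \<sigma> u = (\<Sum>p<e. l p * u ^ 2 ^ p)"
    using linearized[of \<sigma>] add by (auto simp: additive_map_def)
  have eq: "l p * (y ^ 2 ^ p + \<sigma> y) = 0" if "p < e" for p y
  proof (rule linearized_unique[OF _ that])
    fix u
    have "(\<Sum>p<e. l p * (y ^ 2 ^ p + \<sigma> y) * u ^ 2 ^ p) = \<sigma> (u * y) + \<sigma> u * \<sigma> y"
      unfolding l[of "u * y"] l[of u] sum_distrib_right sum.distrib[symmetric]
      by (intro sum.cong refl) (simp add: algebra_simps power_mult_distrib)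
    then show "(\<Sum>p<e. l p * (y ^ 2 ^ p + \<sigma> y) * u ^ 2 ^ p) = 0" by (simp add: mult)
  qed
  have "\<exists>p<e. l p \<noteq> 0"
  proof (rule ccontr)
    assume "\<not> ?thesis"
    then have "\<sigma> 1 = 0" by (simp add: l)
    with one show False by simp
  qed
  then obtain p where "p < e" "l p \<noteq> 0" by blast
  with eq that show thesis by (metis add_eq_0 mult_eq_0_iff)
qed

text \<open>This orthogonality relation later extracts coefficients of functions of
  \<open>d\<close>. If some nonzero \<open>a\<close> has \<open>a ^ n \<noteq> 1\<close>, the
  substitution of \<open>a * d\<close> for \<open>d\<close> multiplies the sum by
  \<open>a ^ n\<close>, so it vanishes.\<close>

lemma power_sum:
  "(\<Sum>d\<in>UNIV - {0}. (d::'a) ^ n) = (if (2 ^ e - 1) dvd n then 1 else 0)"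
proof (cases "(2 ^ e - 1) dvd n")
  case True
  have "odd (card (UNIV - {0::'a}))" using card e_pos by (simp add: card_Diff_subset)
  then have "(of_nat (card (UNIV - {0::'a})) :: 'a) = 1"
    by (elim oddE) (simp add: two)
  moreover have "(\<Sum>d\<in>UNIV - {0}. (d::'a) ^ n) = (\<Sum>d\<in>UNIV - {0::'a}. 1)"
  proof (intro sum.cong refl)
    fix d :: 'a assume "d \<in> UNIV - {0}"
    with True show "d ^ n = 1" by (metis DiffD2 dvdE insertI1 power_mult power_one power_order)
  qed
  ultimately show ?thesis using True by (simp only: if_True sum_constant mult_1_right)
next
  case False
  define M r where "M = (2 ^ e - 1 :: nat)" and "r = n mod M"
  have M: "0 < M" using one_less_power[of "2::nat" e] e_pos by (simp add: M_def)
  have r: "0 < r" "r < M" using False M unfolding r_def M_def[symmetric] by (auto simp: dvd_eq_mod_eq_0)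
  have pow: "d ^ n = d ^ r" if "d \<noteq> 0" for d :: 'a
  proof -
    have "d ^ n = d ^ (M * (n div M) + r)" by (simp add: r_def)
    also have "\<dots> = (d ^ M) ^ (n div M) * d ^ r" by (simp only: power_add power_mult)
    also have "d ^ M = 1" unfolding M_def using that by (rule power_order)
    finally show ?thesis by simp
  qed
  have "\<exists>d::'a. d \<noteq> 0 \<and> d ^ n \<noteq> 1"
  proof (rule ccontr)
    assume "\<not> ?thesis"
    then have *: "d ^ r = 1" if "d \<noteq> 0" for d :: 'a using pow that by auto
    define P :: "'a poly" where "P = monom 1 r - 1"
    have "coeff P r = 1" using r by (simp add: P_def)
    then have "P \<noteq> 0" by auto
    moreover have "degree P \<le> r" unfolding P_def by (rule degree_diff_le) (auto simp: degree_monom_le)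
    moreover have "UNIV - {0} \<subseteq> {x. poly P x = 0}" by (auto simp: P_def poly_monom *)
    then have "card (UNIV - {0::'a}) \<le> card {x. poly P x = 0}" by (intro card_mono) auto
    moreover have "card (UNIV - {0::'a}) = M" using card by (simp add: M_def card_Diff_subset)
    ultimately show False using card_poly_roots_bound[of P] r by linarith
  qed
  then obtain a :: 'a where a: "a \<noteq> 0" "a ^ n \<noteq> 1" by blast
  have "(\<Sum>d\<in>UNIV - {0}. d ^ n) = (\<Sum>d\<in>UNIV - {0}. (a * d) ^ n)"
    by (rule sum.reindex_bij_witness[of _ "\<lambda>y. a * y" "\<lambda>y. y / a"]) (use a in auto)
  also have "\<dots> = a ^ n * (\<Sum>d\<in>UNIV - {0}. d ^ n)"
    by (simp only: power_mult_distrib sum_distrib_left)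
  finally have "(\<Sum>d\<in>UNIV - {0::'a}. d ^ n) = 0" using a by simp
  with False show ?thesis by (simp only: if_False)
qed

definition Tr :: "'a \<Rightarrow> 'a" where "Tr x = (\<Sum>j<e. x ^ 2 ^ j)"

lemma Tr_add: "Tr (x + y) = Tr x + Tr y"
  by (simp add: Tr_def frob_add sum.distrib)

lemma Tr_0 [simp]: "Tr 0 = 0"
  using Tr_add[of 0 0] by simp

lemma Tr_sum: "Tr (sum f A) = (\<Sum>x\<in>A. Tr (f x))"
  by (rule additive_sum) (simp add: additive_map_def Tr_add)

lemma Tr_frob: "Tr (x ^ 2 ^ k) = Tr x"
proof (induction k)
  case (Suc k)
  have sq: "Tr (y\<^sup>2) = Tr y" for y
  proof -
    have "y + Tr (y\<^sup>2) = (\<Sum>j<Suc e. y ^ 2 ^ j)"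
      unfolding Tr_def sum.lessThan_Suc_shift by (simp add: power_mult)
    also have "\<dots> = y + Tr y" by (simp add: Tr_def frob_e add.commute)
    finally show ?thesis by simp
  qed
  have "x ^ 2 ^ Suc k = (x ^ 2 ^ k)\<^sup>2" by (simp add: power_mult power2_commute_frob)
  then show ?case using sq Suc by simp
qed simp

lemma Tr_cases: "Tr x = 0 \<or> Tr x = 1"
proof -
  have "(Tr x)\<^sup>2 = Tr (x\<^sup>2)"
    unfolding Tr_def using sum_frob[of "\<lambda>j. x ^ 2 ^ j" "{..<e}" 1] by (simp add: power2_commute_frob)
  then have "(Tr x)\<^sup>2 = Tr x" using Tr_frob[of x 1] by simp
  then have "Tr x * (Tr x + 1) = 0" by (simp only: power2_eq_square distrib_left mult_1_right add_self)
  then show ?thesis by (simp add: add_eq_0)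
qed

lemma Tr_neq_0: "Tr x \<noteq> 0 \<longleftrightarrow> Tr x = 1"
  using Tr_cases[of x] by auto

lemma ex_Tr_1: "\<exists>x. Tr x = 1"
proof (rule ccontr)
  assume "\<not> ?thesis"
  then have "Tr x = 0" for x using Tr_cases by blast
  then have "(1::'a) = 0" by (intro linearized_unique[of "\<lambda>_. 1" 0]) (auto simp: Tr_def e_pos)
  then show False by simp
qed

lemma Tr_nondegenerate:
  assumes "\<And>x. Tr (x * c) = 0"
  shows "c = 0"
proof (rule ccontr)
  assume "c \<noteq> 0"
  obtain x where "Tr x = 1" using ex_Tr_1 by blast
  with assms[of "x / c"] \<open>c \<noteq> 0\<close> show False by simp
qed

text \<open>Additive Hilbert 90: the image of \<open>y \<mapsto> y + \<tau>(y)\<close> lies in the kernel of the trace, and both have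
  index \<open>2\<close>.\<close>

lemma Tr_eq_1_if_not_in_range:
  assumes fix_t: "\<And>x::'a. x ^ 2 ^ t = x \<Longrightarrow> x = 0 \<or> x = 1"
    and w: "w \<notin> range (\<lambda>y::'a. y + y ^ 2 ^ t)"
  shows "Tr w = 1"
proof -
  define \<phi> where "\<phi> y = y + y ^ 2 ^ t" for y :: 'a
  define K where "K = {w. Tr w = 0}"
  have sub: "range \<phi> \<subseteq> K" by (auto simp: \<phi>_def K_def Tr_add Tr_frob)
  \<comment> \<open>Each \<open>y\<close> differs from the chosen preimage of
    \<open>\<phi> y\<close> by an element of the kernel \<open>{0, 1}\<close>, so the range of
    \<open>\<phi>\<close> contains at least half of the field.\<close>
  have "UNIV \<subseteq> (\<lambda>(w, c). inv \<phi> w + c) ` (range \<phi> \<times> {0, 1})"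
  proof
    fix y
    define z where "z = inv \<phi> (\<phi> y)"
    have "\<phi> z = \<phi> y" by (simp add: z_def f_inv_into_f)
    moreover have "(y + z) ^ 2 ^ t + (y + z) = \<phi> z + \<phi> y" by (simp add: \<phi>_def frob_add ac_simps)
    ultimately have "(y + z) ^ 2 ^ t = y + z" by (simp add: add_eq_0)
    then have "y + z = 0 \<or> y + z = 1" by (rule fix_t)
    moreover have "y = z + (y + z)" by (simp add: ac_simps)
    ultimately have "y = z + 0 \<or> y = z + 1" by metis
    then show "y \<in> (\<lambda>(w, c). inv \<phi> w + c) ` (range \<phi> \<times> {0, 1})"
      unfolding z_def by force
  qed
  then have "CARD('a) \<le> card (range \<phi> \<times> {0::'a, 1})"
    by (meson card_image_le card_mono finite order_trans)
  moreover have "card K + card K = CARD('a)"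
  proof -
    obtain a where a: "Tr a = 1" using ex_Tr_1 by blast
    have "bij_betw ((+) a) K (- K)"
      by (rule bij_betw_byWitness[of _ "(+) a"]) (use a in \<open>auto simp: K_def Tr_add add_eq_0 Tr_neq_0\<close>)
    then have "card K = card (- K)" by (rule bij_betw_same_card)
    moreover have "card K + card (- K) = CARD('a)"
      by (metis Compl_disjoint Compl_partition card_Un_disjoint finite)
    ultimately show ?thesis by simp
  qed
  ultimately have "card K \<le> card (range \<phi>)" by (simp add: card_cartesian_product)
  with sub have "range \<phi> = K" by (meson card_seteq finite)
  with w have "w \<notin> K" by (simp add: \<phi>_def[abs_def])
  then show ?thesis using Tr_cases by (auto simp: K_def)
qed

end

lemma even_card_field_2e:
  assumes "even CARD('a::{field,finite})"
  obtains e where "field_2e TYPE('a) e"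
proof -
  interpret char_2 "TYPE('a)" by unfold_locales (rule two_eq_0_if_even_card[OF assms])
  obtain e where "interpolating_subgroup e (UNIV :: 'a set)" using ex_interpolating_UNIV by blast
  then have "field_2e TYPE('a) e" by unfold_locales (simp add: interpolating_subgroup_def)
  then show thesis by (rule that)
qed

section \<open>Sums of three powers of two\<close>

text \<open>Divide by the smallest power and compare parities. Equal exponents are allowed, so a sum
  may also be a single power.\<close>

lemma two_powers_eq:
  assumes "(2::nat) ^ b + 2 ^ c = 2 ^ b' + 2 ^ c'" "b \<le> c" "b' \<le> c'"
  shows "b = b' \<and> c = c'"
proof -
  have aux: "b = b' \<and> c = c'" if "(2::nat) ^ b + 2 ^ c = 2 ^ b' + 2 ^ c'" "b \<le> c" "b' \<le> c'" "b \<le> b'" for b c b' c'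
  proof -
    obtain x y where c: "c = b + x" and b': "b' = b + y"
      using \<open>b \<le> c\<close> \<open>b \<le> b'\<close> by (meson le_Suc_ex)
    moreover obtain z where "c' = b' + z" using \<open>b' \<le> c'\<close> by (meson le_Suc_ex)
    ultimately have c': "c' = b + y + z" by simp
    have "2 ^ b * (1 + 2 ^ x) = 2 ^ b * ((2::nat) ^ y + 2 ^ (y + z))"
      using that(1) unfolding c b' c' power_add by (simp only: distrib_left mult_1_right mult.assoc)
    then have eq: "1 + 2 ^ x = (2::nat) ^ y + 2 ^ (y + z)" by (simp only: mult_cancel1) simp
    show ?thesis
    proof (cases y)
      case 0
      with eq show ?thesis by (simp add: c b' c')
    next
      case (Suc n)
      have "even (1 + (2::nat) ^ x)" unfolding eq Suc by simp
      then have "x = 0" by (cases x) auto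
      with eq have "2 = (2::nat) ^ y + 2 ^ (y + z)" by simp
      moreover have "2 \<le> (2::nat) ^ y" "0 < (2::nat) ^ (y + z)" by (auto simp: Suc)
      ultimately show ?thesis by linarith
    qed
  qed
  show ?thesis using aux[of b c b' c'] aux[of b' c' b c] assms by (cases "b \<le> b'") auto
qed

text \<open>Binary expansion determines the exponents up to a carry. With three summands the only
  ambiguity is \<open>2 ^ a + 2 ^ a = 2 ^ Suc a\<close> on one side against
  \<open>2 ^ y + 2 ^ y = 2 ^ Suc y\<close> on the other.\<close>

lemma three_powers_eq_sorted:
  assumes eq: "(2::nat) ^ a + 2 ^ b + 2 ^ c = 2 ^ a' + 2 ^ b' + 2 ^ c'"
    and "a \<le> b" "b \<le> c" "a' \<le> b'" "b' \<le> c'" "a \<le> a'"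
  shows "a = a' \<and> b = b' \<and> c = c' \<or> (\<exists>y. b = a \<and> c = Suc y \<and> a' = Suc a \<and> b' = y \<and> c' = y)"
proof (cases "a = a'")
  case True
  with two_powers_eq[of b c b' c'] assms show ?thesis by simp
next
  case False
  obtain x y where b: "b = a + x" and c: "c = a + x + y" using assms by (metis le_Suc_ex)
  obtain u v w where a': "a' = Suc a + u" and b': "b' = Suc a + u + v" and c': "c' = Suc a + u + v + w"
    using assms False by (metis le_Suc_ex le_neq_implies_less Suc_leI)
  have "2 ^ a * (1 + 2 ^ x + 2 ^ (x + y)) = 2 ^ a * (2 * ((2::nat) ^ u + 2 ^ (u + v) + 2 ^ (u + v + w)))"
    using eq by (simp add: a' b' c' b c power_add algebra_simps)
  then have eq': "1 + 2 ^ x + 2 ^ (x + y) = 2 * ((2::nat) ^ u + 2 ^ (u + v) + 2 ^ (u + v + w))" by (simp only: mult_cancel1) simp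
  have "even (1 + (2::nat) ^ x + 2 ^ (x + y))" unfolding eq' by simp
  then have x: "x = 0" and "0 < y" by (cases x; cases y; simp)+
  then obtain z where z: "y = Suc z" using gr0_implies_Suc by blast
  have eq2: "1 + 2 ^ z = (2::nat) ^ u + 2 ^ (u + v) + 2 ^ (u + v + w)"
    using eq' by (simp add: x z)
  have u: "u = 0"
  proof (rule ccontr)
    assume u: "u \<noteq> 0"
    then obtain u' where u': "u = Suc u'" using not0_implies_Suc by blast
    have "even (1 + (2::nat) ^ z)" unfolding eq2 u' by simp
    then have "z = 0" by (cases z) auto
    then have "2 = (2::nat) ^ u + 2 ^ (u + v) + 2 ^ (u + v + w)" using eq2 by simp
    moreover have "2 \<le> (2::nat) ^ u" "1 \<le> (2::nat) ^ (u + v)" using u by (auto simp: u')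
    ultimately show False by linarith
  qed
  then have eq3: "2 ^ z = (2::nat) ^ v + 2 ^ (v + w)" using eq2 by simp
  \<comment> \<open>Multiplying by four lets the single power on the left be written as a sum of
    two, as \<open>two_powers_eq\<close> expects.\<close>
  have "2 ^ Suc z + 2 ^ Suc z = (2::nat) ^ (Suc v + 1) + 2 ^ (Suc v + w + 1)"
    using eq3 by simp
  then have "Suc z = Suc v + 1 \<and> Suc z = Suc v + w + 1" by (intro two_powers_eq) auto
  then show ?thesis by (intro disjI2 exI[of _ "Suc a + v"]) (simp add: b c a' b' c' x z u)
qed

lemma ex_sorted_triple: "\<exists>x y z. x \<le> y \<and> y \<le> z \<and> {#a, b, c#} = {#x, y, z::nat#}"
proof -
  have "\<exists>x y z. x \<le> y \<and> y \<le> z \<and> {#a, b, c#} = {#x, y, z#}" if "a \<le> b" for a b c :: nat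
  proof -
    consider "b \<le> c" | "a \<le> c" "c \<le> b" | "c \<le> a" by linarith
    then show ?thesis using that by cases (metis add_mset_commute)+
  qed
  from this[of a b c] this[of b a c] show ?thesis by (metis add_mset_commute nat_le_linear)
qed

lemma three_powers_eq:
  assumes "(2::nat) ^ a + 2 ^ b + 2 ^ c = 2 ^ a' + 2 ^ b' + 2 ^ c'"
  shows "{#a, b, c#} = {#a', b', c'#} \<or>
    (\<exists>x y. {#a, b, c#} = {#x, x, Suc y#} \<and> {#a', b', c'#} = {#y, y, Suc x#})"
proof -
  let ?S = "\<lambda>M. \<Sum>x\<in>#M. (2::nat) ^ x"
  obtain x y z where L: "x \<le> y" "y \<le> z" "{#a, b, c#} = {#x, y, z#}" using ex_sorted_triple by blast
  obtain x' y' z' where R: "x' \<le> y'" "y' \<le> z'" "{#a', b', c'#} = {#x', y', z'#}" using ex_sorted_triple by blast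
  have "?S {#a, b, c#} = ?S {#a', b', c'#}" using assms by simp
  then have eq: "(2::nat) ^ x + 2 ^ y + 2 ^ z = 2 ^ x' + 2 ^ y' + 2 ^ z'" by (simp add: L R)
  show ?thesis
  proof (cases "x \<le> x'")
    case True
    from three_powers_eq_sorted[OF eq L(1,2) R(1,2) True] show ?thesis
    proof (elim disjE exE conjE)
      fix w assume "y = x" "z = Suc w" "x' = Suc x" "y' = w" "z' = w"
      then show ?thesis unfolding L R
        by (intro disjI2 exI[of _ x] exI[of _ w]) (simp add: add_mset_commute)
    qed (simp add: L R)
  next
    case False
    then have "x' \<le> x" by simp
    from three_powers_eq_sorted[OF eq[symmetric] R(1,2) L(1,2) this] show ?thesis
    proof (elim disjE exE conjE)
      fix w assume "y' = x'" "z' = Suc w" "x = Suc x'" "y = w" "z = w"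
      then show ?thesis unfolding L R
        by (intro disjI2 exI[of _ w] exI[of _ x']) (simp add: add_mset_commute)
    qed (simp add: L R)
  qed
qed

text \<open>The exponents of \<open>d\<close> in \<open>Tr (\<tau>(d) L(\<tau>(d) / d))\<close>, with \<open>\<tau>(d)\<close> the \<open>2\<^sup>t\<close>-th power of \<open>d\<close> and \<open>L\<close> linearized, are sums
  of three powers of \<open>2\<close> modulo \<open>2\<^sup>e - 1\<close> up to a common shift. The two solutions with \<open>{p, P} = {0, t + 1}\<close> reflect
  the family \<open>L(u) = au + \<tau>(a) u\<^sup>\<sigma>\<close> with \<open>\<sigma>(u) = \<tau>(u)\<^sup>2\<close>.\<close>

definition exponent_solution :: "nat \<Rightarrow> nat \<Rightarrow> nat \<Rightarrow> nat \<Rightarrow> nat \<Rightarrow> bool" where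
  "exponent_solution e t p P j \<longleftrightarrow> j = 0 \<and> P = p \<or> p = 0 \<and> P = 0 \<and> t + 1 = e \<or>
     t + 1 < e \<and> p = t + 1 \<and> P = 0 \<and> j = t \<or> t + 1 < e \<and> p = 0 \<and> P = t + 1 \<and> j + t = e"

definition small_exponents :: "nat \<Rightarrow> nat \<Rightarrow> bool" where
  "small_exponents e t \<longleftrightarrow> (\<forall>p\<in>{..<e}. \<forall>P\<in>{..<e}. \<forall>j\<in>{..<e}.
    (2 ^ (t + j) + 2 ^ (t + P + j) + 2 ^ p) mod (2 ^ e - 1 :: nat) = (2 ^ t + 2 ^ (t + p) + 2 ^ (P + j)) mod (2 ^ e - 1)
    \<longrightarrow> exponent_solution e t p P j)"

text \<open>For \<open>e < 7\<close> the six exponents may leave no admissible rotation, so these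
  cases are computed. The pairs are exactly those with \<open>t < e\<close> that satisfy
  \<open>e1\<close>, \<open>e2\<close> and \<open>e4\<close> of \<open>exponents\<close>.\<close>

lemma small_exponents_hold:
  "small_exponents 1 0" "small_exponents 2 1" "small_exponents 3 1" "small_exponents 3 2" "small_exponents 4 3"
  "small_exponents 5 2" "small_exponents 5 3" "small_exponents 5 4" "small_exponents 6 2" "small_exponents 6 4" "small_exponents 6 5"
  by (simp_all add: small_exponents_def exponent_solution_def lessThan_nat_numeral lessThan_Suc power_add)

lemma power_mod_mersenne: "(2::nat) ^ n mod (2 ^ e - 1) = 2 ^ (n mod e) mod (2 ^ e - 1)"
proof -
  have "(2::nat) ^ e mod (2 ^ e - 1) = 1 mod (2 ^ e - 1)"
    by (metis add.commute le_add_diff_inverse2 mod_add_self1 one_le_numeral one_le_power)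
  then have "((2::nat) ^ e) ^ (n div e) mod (2 ^ e - 1) = 1 mod (2 ^ e - 1)"
    by (metis power_mod power_one)
  then have "(2 ^ e) ^ (n div e) * 2 ^ (n mod e) mod (2 ^ e - 1) = (2::nat) ^ (n mod e) mod (2 ^ e - 1)"
    by (metis mod_mult_left_eq mult_1)
  then show ?thesis by (simp flip: power_mult power_add)
qed

lemma dvd_diff_if_mod_eq:
  assumes "(x + r) mod e = (y + r) mod (e::nat)"
  shows "int e dvd int x - int y"
proof -
  have "int e dvd int (x + r) - int (y + r)"
    using assms by (metis mod_eq_dvd_iff of_nat_mod)
  then show ?thesis by simp
qed

lemma dvd_diff_Suc_if_mod_eq:
  assumes "(x + r) mod e = Suc ((y + r) mod (e::nat))"
  shows "int e dvd int x - int y - 1"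
proof -
  have "(x + r) mod e = (y + 1 + r) mod e" using assms by (metis add.commute add_Suc mod_Suc_eq mod_mod_trivial plus_1_eq_Suc add.assoc)
  from dvd_diff_if_mod_eq[OF this] show ?thesis by (simp add: algebra_simps)
qed

lemma mset_triple_eqD:
  assumes "{#a, b, c#} = {#x, y, z#}"
  shows "a = x \<and> b = y \<and> c = z \<or> a = x \<and> b = z \<and> c = y \<or> a = y \<and> b = x \<and> c = z \<or>
     a = y \<and> b = z \<and> c = x \<or> a = z \<and> b = x \<and> c = y \<or> a = z \<and> b = y \<and> c = x"
proof -
  have pair: "b = y \<and> c = z \<or> b = z \<and> c = y" if "{#b, c#} = {#y, z#}" for b c y z :: 'a
    using that by (auto simp: add_eq_conv_ex)
  have "a \<in># {#x, y, z#}" using assms by (metis union_single_eq_member)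
  then consider "a = x" | "a = y" | "a = z" by auto
  then show ?thesis
  proof cases
    case 1
    then have "{#b, c#} = {#y, z#}" using assms by simp
    with 1 pair show ?thesis by blast
  next
    case 2
    then have "{#b, c#} = {#x, z#}" using assms add_mset_commute[of x y] by simp
    with 2 pair show ?thesis by blast
  next
    case 3
    then have "{#b, c#} = {#x, y#}" using assms by (simp add: add_mset_commute[of y z] add_mset_commute[of x z])
    with 3 pair show ?thesis by blast
  qed
qed

lemma dvd_lincomb3:
  assumes "(n::int) dvd a" "n dvd b" "n dvd c" "x = k * a + l * b + m * c"
  shows "n dvd x"
  unfolding assms(4) by (intro dvd_add dvd_mult assms(1-3))

lemma exponents:
  fixes e t p P j :: nat
  assumes less: "t < e" "p < e" "P < e" "j < e"
    and e1: "e = 1 \<or> t \<noteq> 0" and e2: "e = 2 \<or> 2 * t \<noteq> e" and e4: "\<not> (t = 1 \<and> 4 \<le> e)"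
    and eq: "(2 ^ (t + j) + 2 ^ (t + P + j) + 2 ^ p) mod (2 ^ e - 1 :: nat) = (2 ^ t + 2 ^ (t + p) + 2 ^ (P + j)) mod (2 ^ e - 1)"
  shows "exponent_solution e t p P j"
\<comment> \<open>For \<open>e \<ge> 7\<close> the six exponents can be rotated away from \<open>e - 1\<close>, which turns the congruence into an equality.\<close>
proof (cases "e < 7")
  case True
  have "(e, t) \<in> {(1, 0), (2, 1), (3, 1), (3, 2), (4, 3), (5, 2), (5, 3), (5, 4), (6, 2), (6, 4), (6, 5)}"
    using True less(1) e1 e2 e4 by (simp only: insert_iff empty_iff prod.inject; presburger)
  then have "small_exponents e t" using small_exponents_hold by auto
  then show ?thesis using less eq by (simp add: small_exponents_def)
next
  case False
  define A1 A2 A3 B1 B2 B3 where "A1 = t + j" and "A2 = t + P + j" and "A3 = p"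
    and "B1 = t" and "B2 = t + p" and "B3 = P + j"
  note defs = A1_def A2_def A3_def B1_def B2_def B3_def
  \<comment> \<open>A rotation by \<open>r < e\<close> moves the exponent \<open>x\<close> to
    \<open>e - 1\<close> exactly if \<open>r = e - 1 - x mod e\<close>, so six exponents exclude at
    most six rotations.\<close>
  define bad where "bad = (\<lambda>x. (e - 1 - x mod e)) ` {A1, A2, A3, B1, B2, B3}"
  have "card bad \<le> card {A1, A2, A3, B1, B2, B3}" unfolding bad_def by (rule card_image_le) simp
  also have "\<dots> \<le> 6" by (simp add: card_insert_if)
  finally have "card bad < card {..<e}" using False by simp
  then obtain r where r: "r < e" "r \<notin> bad"
    by (metis card_mono finite_imageI finite.emptyI finite.insertI bad_def lessThan_iff linorder_not_less subsetI)
  define f where "f x = (x + r) mod e" for x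
  have f: "f x \<le> e - 2" if "x \<in> {A1, A2, A3, B1, B2, B3}" for x
  proof -
    have "f x \<noteq> e - 1"
    proof
      assume fx: "f x = e - 1"
      have "r = e - 1 - x mod e"
      proof -
        have *: "f x = (x mod e + r) mod e" by (simp add: f_def mod_add_left_eq)
        have "x mod e < e" using less by simp
        show ?thesis
        proof (cases "x mod e + r < e")
          case True
          then show ?thesis using * fx by simp
        next
          case False
          then have "f x = x mod e + r - e"
            using * \<open>x mod e < e\<close> r(1) by (metis le_mod_geq linorder_not_less mod_less add_less_imp_less_left le_add_diff_inverse add_strict_mono)
          then show ?thesis using fx \<open>x mod e < e\<close> r(1) by linarith
        qed
      qed
      with r(2) that show False by (auto simp: bad_def)
    qed
    moreover have "f x < e" using less by (simp add: f_def)
    ultimately show ?thesis by linarith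
  qed
  have sum: "(2::nat) ^ f x + 2 ^ f y + 2 ^ f z < 2 ^ e - 1" if "{x, y, z} \<subseteq> {A1, A2, A3, B1, B2, B3}" for x y z
  proof -
    have "(2::nat) ^ f x \<le> 2 ^ (e - 2)" "(2::nat) ^ f y \<le> 2 ^ (e - 2)" "(2::nat) ^ f z \<le> 2 ^ (e - 2)"
      using f that by (auto intro!: power_increasing)
    then have "(2::nat) ^ f x + 2 ^ f y + 2 ^ f z \<le> 3 * 2 ^ (e - 2)" by linarith
    moreover have "(2::nat) ^ e = 4 * 2 ^ (e - 2)"
    proof -
      obtain k where "e = Suc (Suc k)" using False by (cases e; cases "e - 1") auto
      then show ?thesis by simp
    qed
    moreover have "(2::nat) ^ 1 \<le> 2 ^ (e - 2)" using False by (intro power_increasing) auto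
    ultimately show ?thesis by simp
  qed
  have rot: "(2 ^ f x + 2 ^ f y + 2 ^ f z) mod (2 ^ e - 1) = ((2 ^ x + 2 ^ y + 2 ^ z) * 2 ^ r) mod (2 ^ e - 1 :: nat)" for x y z
  proof -
    have "2 ^ f w mod (2 ^ e - 1) = (2 ^ w * 2 ^ r) mod (2 ^ e - 1 :: nat)" for w
      unfolding f_def power_add[symmetric] by (rule power_mod_mersenne[symmetric])
    then show ?thesis unfolding distrib_right by (intro mod_add_cong)
  qed
  have "((2 ^ A1 + 2 ^ A2 + 2 ^ A3) * 2 ^ r) mod (2 ^ e - 1 :: nat) = ((2 ^ B1 + 2 ^ B2 + 2 ^ B3) * 2 ^ r) mod (2 ^ e - 1)"
    using eq unfolding defs by (metis mod_mult_left_eq)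
  then have "(2 ^ f A1 + 2 ^ f A2 + 2 ^ f A3) mod (2 ^ e - 1 :: nat) = (2 ^ f B1 + 2 ^ f B2 + 2 ^ f B3) mod (2 ^ e - 1)"
    by (simp only: rot)
  then have "(2::nat) ^ f A1 + 2 ^ f A2 + 2 ^ f A3 = 2 ^ f B1 + 2 ^ f B2 + 2 ^ f B3"
    using sum[of A1 A2 A3] sum[of B1 B2 B3] by simp
  from three_powers_eq[OF this]
  have cases: "{#f A1, f A2, f A3#} = {#f B1, f B2, f B3#} \<or>
    (\<exists>x y. {#f A1, f A2, f A3#} = {#x, x, Suc y#} \<and> {#f B1, f B2, f B3#} = {#y, y, Suc x#})" .
  have D: "int e dvd int x - int y" if "f x = f y" for x y
    using that unfolding f_def by (rule dvd_diff_if_mod_eq)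
  have DS: "int e dvd int x - int y - 1" if "f x = Suc (f y)" for x y
    using that unfolding f_def by (rule dvd_diff_Suc_if_mod_eq)
  have bound: "z = 0 \<or> z = int e" if "int e dvd z" "- int e < z" "z < 2 * int e" for z
  proof -
    from that(1) obtain k where k: "z = int e * k" by (elim dvdE)
    have "- 1 < k"
    proof (rule ccontr)
      assume "\<not> - 1 < k"
      then have "int e * k \<le> int e * - 1" by (intro mult_left_mono) auto
      with that(2) show False by (simp add: k)
    qed
    moreover have "k < 2"
    proof (rule ccontr)
      assume "\<not> k < 2"
      then have "int e * 2 \<le> int e * k" by (intro mult_left_mono) auto
      with that(3) show False by (simp add: k)
    qed
    ultimately have "k = 0 \<or> k = 1" by linarith
    then show ?thesis using k by auto
  qed
  have "t \<noteq> 0" using e1 False by simp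
  have "t \<noteq> 1" using e4 False by simp
  have "\<not> int e dvd int t" using bound[of "int t"] \<open>t \<noteq> 0\<close> less by auto
  have not1: "\<not> int e dvd int t - 1" using bound[of "int t - 1"] \<open>t \<noteq> 0\<close> \<open>t \<noteq> 1\<close> less by auto
  have not2: "\<not> int e dvd 2 * int t" using bound[of "2 * int t"] \<open>t \<noteq> 0\<close> less e2 False by auto
  have eqI: "x = y" if "int e dvd int x - int y" "x < e" "y < e" for x y
    using bound[of "int x - int y"] bound[of "int y - int x"] that by (auto simp: dvd_diff_commute)
  have last: "t + 1 = e" if "int e dvd int t + 1" using bound[OF that] less by auto
  \<comment> \<open>The first five alternatives cover the six matchings of the exponents, as a
    single equation suffices in the second and the fourth. The other nine are the carries, one for
    each choice of the odd exponent on either side.\<close>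
  consider "f A1 = f B1" "f A3 = f B3" | "f A2 = f B3" | "f A1 = f B2" "f A2 = f B1" "f A3 = f B3"
    | "f A3 = f B2" | "f A1 = f B3" "f A2 = f B2" "f A3 = f B1"
    | "f A1 = f A2" "f A3 = Suc (f B1)" "f B1 = f B2" "f B3 = Suc (f A1)"
    | "f A1 = f A2" "f A3 = Suc (f B1)" "f B1 = f B3" "f B2 = Suc (f A1)"
    | "f A1 = f A2" "f A3 = Suc (f B2)" "f B2 = f B3" "f B1 = Suc (f A1)"
    | "f A1 = f A3" "f A2 = Suc (f B1)" "f B1 = f B2" "f B3 = Suc (f A1)"
    | "f A1 = f A3" "f A2 = Suc (f B1)" "f B1 = f B3" "f B2 = Suc (f A1)"
    | "f A1 = f A3" "f A2 = Suc (f B2)" "f B2 = f B3" "f B1 = Suc (f A1)"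
    | "f A2 = f A3" "f A1 = Suc (f B1)" "f B1 = f B2" "f B3 = Suc (f A2)"
    | "f A2 = f A3" "f A1 = Suc (f B1)" "f B1 = f B3" "f B2 = Suc (f A2)"
    | "f A2 = f A3" "f A1 = Suc (f B2)" "f B2 = f B3" "f B1 = Suc (f A2)"
    using cases
  proof (elim disjE exE conjE)
    assume "{#f A1, f A2, f A3#} = {#f B1, f B2, f B3#}"
    from mset_triple_eqD[OF this] show thesis using that(1-5) by argo
  next
    fix x y assume "{#f A1, f A2, f A3#} = {#x, x, Suc y#}" "{#f B1, f B2, f B3#} = {#y, y, Suc x#}"
    from mset_triple_eqD[OF this(1)] mset_triple_eqD[OF this(2)] show thesis
      by (elim disjE conjE) (rule that(6-14); simp)+
  qed
  then show ?thesis
  proof cases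
    case 1
    note a = D[OF 1(1)] and b = D[OF 1(2)]
    have "j = 0" by (rule eqI, rule dvd_lincomb3[OF a b b, of _ 1 0 0]) (use less in \<open>auto simp: defs\<close>)
    moreover have "P = p"
      by (rule eqI, rule dvd_lincomb3[OF a b b, of _ "- 1" "- 1" 0]) (use less in \<open>auto simp: defs\<close>)
    ultimately show ?thesis by (simp add: exponent_solution_def)
  next
    case 2
    note a = D[OF 2(1)]
    have "int e dvd int t" by (rule dvd_lincomb3[OF a a a, of _ 1 0 0]) (simp add: defs)
    with \<open>\<not> int e dvd int t\<close> show ?thesis by simp
  next
    case 3
    note a = D[OF 3(1)] and b = D[OF 3(2)] and c = D[OF 3(3)]
    have "p = 0" by (rule eqI, rule dvd_lincomb3[OF a b c, of _ 0 1 1]) (use less in \<open>auto simp: defs\<close>)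
    moreover have "j = 0" by (rule eqI, rule dvd_lincomb3[OF a b c, of _ 1 1 1]) (use less in \<open>auto simp: defs\<close>)
    moreover have "P = 0" by (rule eqI, rule dvd_lincomb3[OF a b c, of _ "- 1" 0 "- 1"]) (use less in \<open>auto simp: defs\<close>)
    ultimately show ?thesis by (simp add: exponent_solution_def)
  next
    case 4
    note a = D[OF 4(1)]
    have "int e dvd int t" by (rule dvd_lincomb3[OF a a a, of _ "- 1" 0 0]) (simp add: defs)
    with \<open>\<not> int e dvd int t\<close> show ?thesis by simp
  next
    case 5
    note a = D[OF 5(1)] and b = D[OF 5(2)] and c = D[OF 5(3)]
    have "p = P" by (rule eqI, rule dvd_lincomb3[OF a b c, of _ 1 0 1]) (use less in \<open>auto simp: defs\<close>)
    moreover have "j = 0" by (rule eqI, rule dvd_lincomb3[OF a b c, of _ 1 1 1]) (use less in \<open>auto simp: defs\<close>)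
    ultimately show ?thesis by (simp add: exponent_solution_def)
  next
    case 6
    note a = D[OF 6(1)] and b = DS[OF 6(2)] and c = D[OF 6(3)]
    have "P = 0" by (rule eqI, rule dvd_lincomb3[OF a b c, of _ "- 1" 0 0]) (use less in \<open>auto simp: defs\<close>)
    moreover have "p = 0" by (rule eqI, rule dvd_lincomb3[OF a b c, of _ 0 0 "- 1"]) (use less in \<open>auto simp: defs\<close>)
    moreover have "t + 1 = e" by (rule last, rule dvd_lincomb3[OF a b c, of _ 0 "- 1" "- 1"]) (simp add: defs)
    ultimately show ?thesis by (simp add: exponent_solution_def)
  next
    case 7
    note a = D[OF 7(1)] and b = DS[OF 7(2)] and c = D[OF 7(3)]
    have P: "P = 0" by (rule eqI, rule dvd_lincomb3[OF a b c, of _ "- 1" 0 0]) (use less in \<open>auto simp: defs\<close>)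
    have j: "j = t" by (rule eqI, rule dvd_lincomb3[OF a b c, of _ 1 0 "- 1"]) (use less in \<open>auto simp: defs\<close>)
    have p: "int e dvd int p - int (t + 1)" by (rule dvd_lincomb3[OF a b c, of _ 0 1 0]) (simp add: defs)
    show ?thesis
    proof (cases "t + 1 = e")
      case True
      then have "int e dvd int p - int 0" using dvd_add[OF p, of "int e"] by simp
      then have "p = 0" by (rule eqI) (use less in auto)
      with True P show ?thesis by (simp add: exponent_solution_def)
    next
      case False
      then have "t + 1 < e" using less by simp
      with eqI[OF p] P j less show ?thesis by (simp add: exponent_solution_def)
    qed
  next
    case 8
    note a = D[OF 8(1)] and b = DS[OF 8(2)] and c = D[OF 8(3)] and d = DS[OF 8(4)]
    have P: "P = 0" by (rule eqI, rule dvd_lincomb3[OF a b c, of _ "- 1" 0 0]) (use less in \<open>auto simp: defs\<close>)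
    have "t + 1 = e" by (rule last, rule dvd_lincomb3[OF a b c, of _ 0 "- 1" 0]) (simp add: defs)
    moreover have m: "int e dvd int p - int j + int t" by (rule dvd_lincomb3[OF a b c, of _ "- 1" 0 1]) (simp add: defs)
    have "p = 0"
      by (rule eqI, rule dvd_lincomb3[OF m b d, of _ 1 1 "- 1"]) (use less in \<open>auto simp: defs\<close>)
    ultimately show ?thesis using P by (simp add: exponent_solution_def)
  next
    case 9
    note a = D[OF 9(1)] and b = DS[OF 9(2)] and c = D[OF 9(3)]
    have p: "p = 0" by (rule eqI, rule dvd_lincomb3[OF a b c, of _ 0 0 "- 1"]) (use less in \<open>auto simp: defs\<close>)
    have "int e dvd int t + int j" by (rule dvd_lincomb3[OF a b c, of _ 1 0 "- 1"]) (simp add: defs)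
    then have j: "j + t = e" using bound[of "int t + int j"] less \<open>t \<noteq> 0\<close> by auto
    have P: "int e dvd int P - int (t + 1)" by (rule dvd_lincomb3[OF a b c, of _ "- 1" 1 1]) (simp add: defs)
    show ?thesis
    proof (cases "t + 1 = e")
      case True
      then have "int e dvd int P - int 0" using dvd_add[OF P, of "int e"] by simp
      then have "P = 0" by (rule eqI) (use less in auto)
      with True p show ?thesis by (simp add: exponent_solution_def)
    next
      case False
      then have "t + 1 < e" using less by simp
      with eqI[OF P] p j less show ?thesis by (simp add: exponent_solution_def)
    qed
  next
    case 10
    note a = D[OF 10(1)] and b = DS[OF 10(2)] and c = D[OF 10(3)]
    have "int e dvd int t - 1" by (rule dvd_lincomb3[OF a b c, of _ 0 1 1]) (simp add: defs)
    with not1 show ?thesis by simp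
  next
    case 11
    note a = D[OF 11(1)] and b = DS[OF 11(2)] and c = D[OF 11(3)]
    have "int e dvd int t - 1" by (rule dvd_lincomb3[OF a b c, of _ 0 1 1]) (simp add: defs)
    with not1 show ?thesis by simp
  next
    case 12
    note a = D[OF 12(1)] and b = DS[OF 12(2)] and c = D[OF 12(3)] and d = DS[OF 12(4)]
    have p: "p = 0" by (rule eqI, rule dvd_lincomb3[OF a b c, of _ 0 0 "- 1"]) (use less in \<open>auto simp: defs\<close>)
    have t: "t + 1 = e" by (rule last, rule dvd_lincomb3[OF a b d, of _ 0 0 "- 1"]) (simp add: defs)
    have "P = 0" by (rule eqI, rule dvd_lincomb3[OF a b d, of _ 1 "- 1" 1]) (use less p in \<open>auto simp: defs\<close>)
    with t p show ?thesis by (simp add: exponent_solution_def)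
  next
    case 13
    note a = D[OF 13(1)] and b = D[OF 13(3)] and d = DS[OF 13(4)]
    have "int e dvd int t - 1" by (rule dvd_lincomb3[OF a b d, of _ 1 0 1]) (simp add: defs)
    with not1 show ?thesis by simp
  next
    case 14
    note a = D[OF 14(1)] and b = D[OF 14(3)]
    have "int e dvd 2 * int t" by (rule dvd_lincomb3[OF a b b, of _ 1 1 0]) (simp add: defs)
    with not2 show ?thesis by simp
  qed
qed

section \<open>Additive maps with vanishing twisted trace\<close>

text \<open>The integer identity behind \<open>exp_eq_iff\<close>, with \<open>a\<close>,
  \<open>x\<close>, \<open>y\<close>, \<open>z\<close> standing for \<open>2 ^ t\<close>,
  \<open>2 ^ P\<close>, \<open>2 ^ j\<close>, \<open>2 ^ p\<close> and \<open>m\<close> for the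
  modulus.\<close>

lemma twist_ring:
  "(a + a * x + m - x) * y + (a + a * z + m - z) * (m - 1) =
     (a * y + a * x * y + z) - (a + a * z + x * y) + m * (y + (a + a * z + m - z) - (1::int))"
  by algebra

context field_2e
begin

lemma frob_id_dvd:
  assumes "\<And>x::'a. x ^ 2 ^ k = x"
  shows "e dvd k"
proof (rule ccontr)
  define r where "r = k mod e"
  assume "\<not> e dvd k"
  then have r: "0 < r" "r < e" using e_pos by (auto simp: r_def dvd_eq_mod_eq_0)
  have "(\<Sum>p<e. (of_bool (p = 0) + of_bool (p = r)) * x ^ 2 ^ p) = 0" for x :: 'a
  proof -
    have "(\<Sum>p<e. (of_bool (p = 0) + of_bool (p = r)) * x ^ 2 ^ p) =
        (\<Sum>p<e. of_bool (p = 0) * x ^ 2 ^ p) + (\<Sum>p<e. of_bool (p = r) * x ^ 2 ^ p)"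
      by (simp only: distrib_right sum.distrib)
    also have "\<dots> = x + x ^ 2 ^ r" using r by (simp add: of_bool_def if_distrib[of "\<lambda>z. z * _"] cong: if_cong)
    also have "x ^ 2 ^ r = x" using assms frob_mod[of x k] by (simp add: r_def)
    finally show ?thesis by simp
  qed
  from linearized_unique[OF this, of 0] r show False by simp
qed

end

locale frob_twist = field_2e ty e for ty :: "'a::{field,finite} itself" and e +
  fixes t :: nat
  assumes t_less: "t < e"
    and fixed_point: "\<And>x::'a. x ^ 2 ^ t = x \<Longrightarrow> x = 0 \<or> x = 1"
begin

text \<open>\<open>T\<close> and \<open>S\<close> are the automorphisms \<tau> and \<sigma> of the
  overview.\<close>

definition T :: "'a \<Rightarrow> 'a" where "T x = x ^ 2 ^ t"

definition S :: "'a \<Rightarrow> 'a" where "S x = (T x)\<^sup>2"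

lemma S_power: "S x = x ^ 2 ^ Suc t"
  by (simp add: S_def T_def power_mult power2_commute_frob)

lemma T_simps [simp]: "T 0 = 0" "T 1 = 1" "T (x + y) = T x + T y" "T (x * y) = T x * T y" "T (x / y) = T x / T y"
    "T x = T y \<longleftrightarrow> x = y" "T x = 0 \<longleftrightarrow> x = 0" "T (x ^ n) = T x ^ n"
  by (simp_all add: T_def frob_add power_mult_distrib power_divide frob_inj mult.commute flip: power_mult)

lemma S_simps [simp]: "S 0 = 0" "S 1 = 1" "S (x + y) = S x + S y" "S (x * y) = S x * S y" "S (x / y) = S x / S y"
    "S x = 0 \<longleftrightarrow> x = 0"
  by (simp_all add: S_def add_square power_mult_distrib power_divide)

lemma T_eq_self: "T x = x \<longleftrightarrow> x = 0 \<or> x = 1"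
  using fixed_point[of x] by (auto simp: T_def)

lemma twist_nontrivial: "e = 1 \<or> t \<noteq> 0"
proof -
  have "e = 1" if "t = 0"
  proof -
    have "UNIV \<subseteq> {0::'a, 1}" using fixed_point that by auto
    then have "CARD('a) \<le> card {0::'a, 1}" by (intro card_mono) auto
    then have "(2::nat) ^ e \<le> 2 ^ 1" by (simp add: card)
    then have "e \<le> 1" by (simp only: power_increasing_iff)
    then show ?thesis using e_pos by simp
  qed
  then show ?thesis by blast
qed

text \<open>If \<open>T\<close> were an involution, \<open>x * T x\<close> would be fixed by
  \<open>T\<close>, hence \<open>1\<close> for \<open>x \<noteq> 0\<close>. Comparing this at
  \<open>x\<close> and \<open>x + 1\<close> gives \<open>x * x + x = 1\<close> outside
  \<open>{0, 1}\<close>, which leaves at most four elements.\<close>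

lemma twist_not_involution: "e = 2 \<or> 2 * t \<noteq> e"
proof (rule ccontr)
  assume "\<not> ?thesis"
  then have e: "e = t + t" and "e \<noteq> 2" by auto
  have TT: "T (T x) = x" for x
    using frob_e[of x] unfolding e by (simp add: T_def power_add power_mult)
  have norm: "x * T x = 1" if "x \<noteq> 0" for x
    using that T_eq_self[of "x * T x"] by (simp add: TT mult.commute)
  have quad: "x * x + x = 1" if "x \<noteq> 0" "x \<noteq> 1" for x :: 'a
  proof -
    have "x + 1 \<noteq> 0" using that by (simp add: add_eq_0)
    have "(x + 1) * T (x + 1) = x * T x + x + (T x + 1)" by (simp add: algebra_simps)
    then have "1 + x + (T x + 1) = 1" using norm[OF that(1)] norm[OF \<open>x + 1 \<noteq> 0\<close>] by simp
    then have "x + T x = 1" by (simp add: ac_simps)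
    then have "x * (x + T x) = x" by simp
    then have "x * x + 1 = x" using norm[OF that(1)] by (simp add: distrib_left)
    then show ?thesis by (metis add.assoc add.commute add_self_left)
  qed
  have "\<exists>r. UNIV \<subseteq> {0, 1, r, r + 1 :: 'a}"
  proof (cases "\<exists>r::'a. r \<noteq> 0 \<and> r \<noteq> 1")
    case True
    then obtain r :: 'a where r: "r \<noteq> 0" "r \<noteq> 1" by blast
    have "x = r \<or> x = r + 1" if "x \<noteq> 0" "x \<noteq> 1" for x
    proof -
      have "(x + r) * (x + r + 1) = (x * x + x) + (r * r + r) + (x * r + x * r)" by (simp add: algebra_simps)
      also have "\<dots> = 0" using quad[OF that] quad[OF r] by simp
      finally have "x + r = 0 \<or> x + r + 1 = 0" by simp
      then show ?thesis by (simp add: add_eq_0 add.assoc)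
    qed
    then show ?thesis by blast
  qed blast
  then obtain r where "UNIV \<subseteq> {0, 1, r, r + 1 :: 'a}" by blast
  then have "CARD('a) \<le> card {0, 1, r, r + 1}" by (intro card_mono) auto
  also have "\<dots> \<le> 4" by (simp add: card_insert_if)
  finally have "(2::nat) ^ e \<le> 2 ^ 2" by (simp add: card)
  then have "e \<le> 2" by (simp only: power_increasing_iff)
  with e \<open>e \<noteq> 2\<close> e_pos show False by simp
qed

text \<open>The exponent of \<open>d\<close> in \<open>T d * (T d / d) ^ 2 ^ p\<close>; the negative
  part \<open>- 2 ^ p\<close> is shifted by \<open>2 ^ e - 1\<close> to stay in the natural
  numbers.\<close>

definition twist_exp :: "nat \<Rightarrow> nat" where
  "twist_exp p = 2 ^ t + 2 ^ (t + p) + (2 ^ e - 1 - 2 ^ p)"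

text \<open>The congruence of \<open>twist_exp P * 2 ^ j\<close> and \<open>twist_exp p\<close>
  modulo \<open>2 ^ e - 1\<close>, with the negative terms moved across.\<close>

definition exp_eq :: "nat \<Rightarrow> nat \<Rightarrow> nat \<Rightarrow> bool" where
  "exp_eq p P j \<longleftrightarrow>
    (2 ^ (t + j) + 2 ^ (t + P + j) + 2 ^ p) mod (2 ^ e - 1 :: nat) = (2 ^ t + 2 ^ (t + p) + 2 ^ (P + j)) mod (2 ^ e - 1)"

lemma pow2_le: "p < e \<Longrightarrow> 2 ^ p \<le> (2 ^ e - 1 :: nat)"
proof -
  assume "p < e"
  then have "(2::nat) ^ p < 2 ^ e" by simp
  then show ?thesis by linarith
qed

lemma Mersenne_int: "int (2 ^ e - 1) = 2 ^ e - 1"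
  by (simp add: of_nat_diff)

lemma int_twist_exp: "p < e \<Longrightarrow> int (twist_exp p) = 2 ^ t + 2 ^ (t + p) + (2 ^ e - 1) - 2 ^ p"
proof -
  assume "p < e"
  then have "int (2 ^ e - 1 - 2 ^ p) = int (2 ^ e - 1) - int (2 ^ p)" by (intro of_nat_diff pow2_le)
  then show ?thesis by (simp only: twist_exp_def of_nat_add of_nat_power of_nat_numeral Mersenne_int)
qed

text \<open>The factor \<open>2 ^ e - 2\<close> is \<open>-1\<close> modulo
  \<open>2 ^ e - 1\<close>, so it expresses subtraction.\<close>

lemma exp_eq_iff:
  assumes "p < e" "P < e"
  shows "(2 ^ e - 1) dvd twist_exp P * 2 ^ j + twist_exp p * (2 ^ e - 2) \<longleftrightarrow> exp_eq p P j"
proof -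
  define M :: int where "M = 2 ^ e - 1"
  have "(2::nat) \<le> 2 ^ e" using e_pos by (cases e) auto
  have "(2 ^ e - 1) dvd twist_exp P * 2 ^ j + twist_exp p * (2 ^ e - 2) \<longleftrightarrow>
      M dvd int (twist_exp P) * 2 ^ j + int (twist_exp p) * (M - 1)"
  proof -
    have "int (2 ^ e - 2) = M - 1" using \<open>2 \<le> 2 ^ e\<close> by (simp add: M_def of_nat_diff)
    moreover have "int (2 ^ e - 1) = M" by (simp only: M_def Mersenne_int)
    ultimately show ?thesis
      unfolding int_dvd_int_iff[symmetric] of_nat_add of_nat_mult by simp
  qed
  also have "\<dots> \<longleftrightarrow> M dvd (2 ^ (t + j) + 2 ^ (t + P + j) + 2 ^ p) - (2 ^ t + 2 ^ (t + p) + 2 ^ (P + j))"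
  proof -
    have "int (twist_exp P) * 2 ^ j + int (twist_exp p) * (M - 1) =
        (2 ^ (t + j) + 2 ^ (t + P + j) + 2 ^ p) - (2 ^ t + 2 ^ (t + p) + 2 ^ (P + j)) + M * (2 ^ j + int (twist_exp p) - 1)"
      unfolding int_twist_exp[OF assms(1)] int_twist_exp[OF assms(2)] M_def[symmetric]
      using twist_ring[of "2 ^ t" "2 ^ P" M "2 ^ j" "2 ^ p"] by (simp only: power_add)
    then show ?thesis by (simp only: dvd_add_left_iff[OF dvd_triv_left])
  qed
  also have "\<dots> \<longleftrightarrow> exp_eq p P j"
    using of_nat_eq_iff[of "(2 ^ (t + j) + 2 ^ (t + P + j) + 2 ^ p) mod (2 ^ e - 1)"
        "(2 ^ t + 2 ^ (t + p) + 2 ^ (P + j)) mod (2 ^ e - 1)", where 'a = int]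
    by (simp only: exp_eq_def mod_eq_dvd_iff M_def Mersenne_int zmod_int of_nat_add of_nat_power of_nat_numeral)
  finally show ?thesis .
qed

lemma exp_eq_solution:
  assumes "\<not> (t = 1 \<and> 4 \<le> e)" "p < e" "P < e" "j < e" "exp_eq p P j"
  shows "exponent_solution e t p P j"
  by (rule exponents[OF t_less assms(2-4) twist_nontrivial twist_not_involution assms(1) assms(5)[unfolded exp_eq_def]])

lemma Tr_twist_expand:
  assumes L: "\<And>u. L u = (\<Sum>p<e. l p * u ^ 2 ^ p)" and d: "d \<noteq> 0"
  shows "Tr (T d * L (T d / d)) = (\<Sum>p<e. \<Sum>j<e. l p ^ 2 ^ j * d ^ (twist_exp p * 2 ^ j))"
proof -
  have "T d * (l p * (T d / d) ^ 2 ^ p) = l p * d ^ twist_exp p" if "p < e" for p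
  proof -
    have "d ^ (2 ^ e - 1 - 2 ^ p) * d ^ 2 ^ p = d ^ (2 ^ e - 1 - 2 ^ p + 2 ^ p)"
      by (rule power_add[symmetric])
    also have "\<dots> = 1"
      using power_order[OF d] by (simp only: le_add_diff_inverse2[OF pow2_le[OF that]])
    finally have "d ^ (2 ^ e - 1 - 2 ^ p) * d ^ 2 ^ p = 1" .
    then have "d ^ (2 ^ e - 1 - 2 ^ p) = 1 / d ^ 2 ^ p" using d by (simp add: field_simps)
    then have "d ^ twist_exp p = T d * (T d) ^ 2 ^ p / d ^ 2 ^ p"
      by (simp add: twist_exp_def T_def power_add power_mult)
    then show ?thesis by (simp add: power_divide)
  qed
  then have "T d * L (T d / d) = (\<Sum>p<e. l p * d ^ twist_exp p)"
    unfolding L sum_distrib_left by (intro sum.cong refl) (simp only: lessThan_iff)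
  then show ?thesis by (simp add: Tr_sum) (simp add: Tr_def power_mult_distrib power_mult)
qed

text \<open>By \<open>power_sum\<close>, summing against \<open>d ^ n\<close> isolates the terms
  whose exponent is congruent to \<open>- n\<close>. The index set lists all pairs that collide
  there.\<close>

lemma Tr_twist_extract:
  assumes L: "\<And>u. L u = (\<Sum>p<e. l p * u ^ 2 ^ p)"
  shows "(\<Sum>d\<in>UNIV - {0}. d ^ n * Tr (T d * L (T d / d))) =
    (\<Sum>(p, j)\<in>{(p, j). p < e \<and> j < e \<and> (2 ^ e - 1) dvd twist_exp p * 2 ^ j + n}. l p ^ 2 ^ j)"
proof -
  have "(\<Sum>d\<in>UNIV - {0}. d ^ n * Tr (T d * L (T d / d))) =
      (\<Sum>d\<in>UNIV - {0}. \<Sum>(p, j)\<in>{..<e} \<times> {..<e}. l p ^ 2 ^ j * d ^ (twist_exp p * 2 ^ j + n))"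
    by (intro sum.cong refl)
      (simp add: Tr_twist_expand[OF L] sum_distrib_left sum.cartesian_product power_add split_def ac_simps)
  also have "\<dots> = (\<Sum>(p, j)\<in>{..<e} \<times> {..<e}. \<Sum>d\<in>UNIV - {0}. l p ^ 2 ^ j * d ^ (twist_exp p * 2 ^ j + n))"
    by (subst sum.swap) (simp add: split_def)
  also have "\<dots> = (\<Sum>x\<in>{..<e} \<times> {..<e}. if (2 ^ e - 1) dvd twist_exp (fst x) * 2 ^ snd x + n then l (fst x) ^ 2 ^ snd x else 0)"
    unfolding split_def by (intro sum.cong refl) (simp add: power_sum flip: sum_distrib_left)
  also have "\<dots> = (\<Sum>x\<in>{x \<in> {..<e} \<times> {..<e}. (2 ^ e - 1) dvd twist_exp (fst x) * 2 ^ snd x + n}. l (fst x) ^ 2 ^ snd x)"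
    by (rule sum.inter_filter[symmetric]) simp
  also have "{x \<in> {..<e} \<times> {..<e}. (2 ^ e - 1) dvd twist_exp (fst x) * 2 ^ snd x + n} =
      {(p, j). p < e \<and> j < e \<and> (2 ^ e - 1) dvd twist_exp p * 2 ^ j + n}"
    by auto
  finally show ?thesis by (simp add: split_def)
qed

lemma exp_eq_refl: "exp_eq p p 0"
  by (simp add: exp_eq_def ac_simps)

text \<open>Both sides reduce to \<open>2 + 2 ^ (t + 1)\<close>. This genuine collision ties the
  coefficients of \<open>u\<close> and \<open>S u\<close> together in
  \<open>linear_twist_0\<close>.\<close>

lemma exp_eq_special:
  assumes "t \<noteq> 0"
  shows "exp_eq 0 (t + 1) (e - t)"
proof -
  have red: "(2 ^ e * x) mod (2 ^ e - 1) = x mod (2 ^ e - 1 :: nat)" for x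
  proof -
    have "2 ^ e * x = x + (2 ^ e - 1) * x" by (simp add: algebra_simps)
    then show ?thesis by (metis mod_mult_self2)
  qed
  have "(2::nat) ^ (t + (e - t)) + 2 ^ (t + (t + 1) + (e - t)) + 2 ^ 0 = 2 ^ e * (1 + 2 ^ (t + 1)) + 1"
    using t_less by (simp add: distrib_left flip: power_add)
  moreover have "(2::nat) ^ t + 2 ^ (t + 0) + 2 ^ ((t + 1) + (e - t)) = 2 ^ e * 2 + 2 ^ (t + 1)"
    using t_less by simp
  moreover have "(2 ^ e * (1 + 2 ^ (t + 1)) + 1) mod (2 ^ e - 1) = (1 + 2 ^ (t + 1) + 1) mod (2 ^ e - 1 :: nat)"
    by (metis red mod_add_left_eq)
  moreover have "(2 ^ e * 2 + 2 ^ (t + 1)) mod (2 ^ e - 1) = (2 + 2 ^ (t + 1)) mod (2 ^ e - 1 :: nat)"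
    by (metis red mod_add_left_eq)
  ultimately show ?thesis unfolding exp_eq_def by (simp add: ac_simps)
qed

text \<open>Comparing coefficients of the powers of \<open>d\<close>: almost all exponents are distinct modulo \<open>q - 1\<close>.\<close>

lemma linear_twist_0:
  assumes t1: "\<not> (t = 1 \<and> 4 \<le> e)" and L: "additive_map L"
    and zero: "\<And>d. d \<noteq> 0 \<Longrightarrow> Tr (T d * L (T d / d)) = 0"
  obtains a b where "\<And>u. L u = a * u + b * S u" and "t + 1 < e \<Longrightarrow> b = T a"
proof -
  obtain l where l: "\<And>u. L u = (\<Sum>p<e. l p * u ^ 2 ^ p)" using linearized[OF L] by blast
  have eq: "(\<Sum>(P, j)\<in>{(P, j). P < e \<and> j < e \<and> exp_eq p P j}. l P ^ 2 ^ j) = 0" if "p < e" for p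
  proof -
    have "{(P, j). P < e \<and> j < e \<and> exp_eq p P j} =
        {(P, j). P < e \<and> j < e \<and> (2 ^ e - 1) dvd twist_exp P * 2 ^ j + twist_exp p * (2 ^ e - 2)}"
      using exp_eq_iff[OF that] by blast
    then show ?thesis
      using Tr_twist_extract[OF l, of "twist_exp p * (2 ^ e - 2)"] zero by simp
  qed
  have l0: "l p = 0" if "p < e" "p \<noteq> 0" "p \<noteq> t + 1" for p
  proof -
    have "{(P, j). P < e \<and> j < e \<and> exp_eq p P j} = {(p, 0)}"
      using exp_eq_solution[OF t1 that(1)] that exp_eq_refl e_pos by (fastforce simp: exponent_solution_def)
    then show ?thesis using eq[OF that(1)] by simp
  qed
  show thesis
  proof (cases "t + 1 < e")
    case True
    then have "t \<noteq> 0" using twist_nontrivial by auto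
    have "{(P, j). P < e \<and> j < e \<and> exp_eq 0 P j} = {(0, 0), (t + 1, e - t)}"
      using exp_eq_solution[OF t1 e_pos] exp_eq_refl[of 0] exp_eq_special[OF \<open>t \<noteq> 0\<close>] \<open>t \<noteq> 0\<close> True
      by (fastforce simp: exponent_solution_def)
    then have "l 0 = l (t + 1) ^ 2 ^ (e - t)" using eq[OF e_pos] by (simp add: add_eq_0)
    then have "T (l 0) = l (t + 1)"
      using t_less frob_e by (simp add: T_def flip: power_mult power_add)
    moreover have "L u = l 0 * u + l (t + 1) * S u" for u
    proof -
      have "L u = (\<Sum>p\<in>{0, t + 1}. l p * u ^ 2 ^ p)"
        unfolding l by (rule sum.mono_neutral_right) (use True l0 in auto)
      then show ?thesis by (simp add: S_power)
    qed
    ultimately show thesis using that by metis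
  next
    case False
    have "L u = l 0 * u + 0 * S u" for u
    proof -
      have "L u = (\<Sum>p\<in>{0}. l p * u ^ 2 ^ p)"
        unfolding l by (rule sum.mono_neutral_right) (use False l0 e_pos in auto)
      then show ?thesis by simp
    qed
    with that False show thesis by blast
  qed
qed

text \<open>Summing over all \<open>d \<noteq> 0\<close> gives \<open>1\<close> on the right, as
  their number is odd. On the left only exponents divisible by \<open>2 ^ e - 1\<close> survive, and
  none exists if \<open>t + 1 < e\<close>.\<close>

lemma linear_twist_1:
  assumes t1: "\<not> (t = 1 \<and> 4 \<le> e)" and L: "additive_map L"
    and one: "\<And>d. d \<noteq> 0 \<Longrightarrow> Tr (T d * L (T d / d)) = 1"
  shows "t + 1 = e"
proof (rule ccontr)
  assume "t + 1 \<noteq> e"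
  with t_less have te: "t + 1 < e" by simp
  obtain l where l: "\<And>u. L u = (\<Sum>p<e. l p * u ^ 2 ^ p)" using linearized[OF L] by blast
  have "\<not> (2 ^ e - 1) dvd twist_exp p * 2 ^ j" if "p < e" "j < e" for p j
  proof
    assume "(2 ^ e - 1) dvd twist_exp p * 2 ^ j"
    then have "(2 ^ e - 1) dvd twist_exp p * 2 ^ j * 2 ^ (e - j)" by (rule dvd_mult2)
    also have "twist_exp p * 2 ^ j * 2 ^ (e - j) = twist_exp p * 2 ^ e"
      using that by (simp add: mult.assoc flip: power_add)
    also have "\<dots> = twist_exp p * (2 ^ e - 1) + twist_exp p"
      by (simp add: algebra_simps)
    finally have "(2 ^ e - 1) dvd twist_exp p" by (simp add: dvd_add_right_iff)
    \<comment> \<open>An exponent congruent to \<open>0\<close> is congruent to its own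
      double.\<close>
    then have "exp_eq p p 1" using exp_eq_iff[OF that(1,1), of 1] by simp
    from exp_eq_solution[OF t1 that(1,1) _ this] te show False by (auto simp: exponent_solution_def)
  qed
  then have E: "{(p, j). p < e \<and> j < e \<and> (2 ^ e - 1) dvd twist_exp p * 2 ^ j + 0} = {}" by auto
  have "(\<Sum>d\<in>UNIV - {0}. d ^ 0 * Tr (T d * L (T d / d))) = 0"
    unfolding Tr_twist_extract[OF l] E by (rule sum.empty)
  moreover have "(\<Sum>d\<in>UNIV - {0}. d ^ 0 * Tr (T d * L (T d / d))) = (\<Sum>d\<in>UNIV - {0::'a}. d ^ 0)"
    using one by (intro sum.cong refl) auto
  ultimately have "(\<Sum>d\<in>UNIV - {0::'a}. d ^ 0) = 0" by metis
  then show False using power_sum[of 0] by (simp only: dvd_0_right if_True) simp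
qed

end

section \<open>Derivatives and the slope condition\<close>

definition dd :: "'a::ab_group_add \<Rightarrow> ('a \<Rightarrow> 'a) \<Rightarrow> 'a \<Rightarrow> 'a" where
  "dd u f x = f (x + u) - f x"

lemma dd_commute: "dd u (dd v f) = dd v (dd u f)"
  by (rule ext) (simp add: dd_def algebra_simps)

lemma dd_zero: "dd 0 f x = 0"
  by (simp add: dd_def)

lemma dd_add: "dd (u + v) f x = dd u f (x + v) + dd v f x"
  by (simp add: dd_def algebra_simps)

lemma degree_dd_poly:
  fixes p :: "'a::idom poly"
  assumes "degree p > 0"
  obtains q where "dd u (poly p) = poly q" "degree q < degree p"
proof
  let ?q = "p \<circ>\<^sub>p [:u, 1:] - p"
  show "dd u (poly p) = poly ?q"
    by (rule ext) (simp add: dd_def poly_pcompose add.commute)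
  have deg: "degree (p \<circ>\<^sub>p [:u, 1:]) = degree p" by (simp add: degree_pcompose)
  have "coeff (p \<circ>\<^sub>p [:u, 1:]) (degree p) = coeff p (degree p)"
    using lead_coeff_comp[of "[:u, 1:]" p] deg by simp
  then have "coeff ?q (degree p) = 0" by simp
  moreover have "degree ?q \<le> degree p" by (rule degree_diff_le) (simp_all add: deg)
  ultimately show "degree ?q < degree p"
    using assms by (metis degree_0 leading_coeff_0_iff order_le_less)
qed

lemma foldr_dd_poly:
  fixes p :: "'a::idom poly"
  shows "degree p < length us \<Longrightarrow> foldr dd us (poly p) x = 0"
proof (induction us arbitrary: p x rule: rev_induct)
  case (snoc u us)
  show ?case
  proof (cases "degree p = 0")
    case True
    then obtain c where p: "p = [:c:]" by (rule degree_eq_zeroE)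
    have "dd u (poly p) = poly 0" by (rule ext) (simp add: dd_def p)
    moreover have "foldr dd us (poly 0) x = (0::'a)" for x
      by (induction us arbitrary: x) (simp_all add: dd_def)
    ultimately show ?thesis by simp
  next
    case False
    then have "degree p > 0" by simp
    then obtain q where "dd u (poly p) = poly q" "degree q < degree p" by (rule degree_dd_poly)
    with snoc show ?thesis by simp
  qed
qed simp

text \<open>Affine with respect to addition only: an additive map plus a constant, not necessarily
  linear over the field.\<close>

definition affine_map :: "('a::ab_group_add \<Rightarrow> 'a) \<Rightarrow> bool" where
  "affine_map f \<longleftrightarrow> (\<forall>u v x. dd u (dd v f) x = 0)"

definition quadratic_map :: "('a::ab_group_add \<Rightarrow> 'a) \<Rightarrow> bool" where
  "quadratic_map f \<longleftrightarrow> (\<forall>u. affine_map (dd u f))"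

lemma affine_map_const: "affine_map f \<Longrightarrow> dd u f x = dd u f 0"
  unfolding affine_map_def by (metis add.left_neutral dd_def eq_iff_diff_eq_0 dd_commute)

lemma affine_mapE:
  assumes "affine_map f"
  obtains L where "additive_map L" "\<And>x. f x = L x + f 0"
proof
  have "f (x + y) - f x = f y - f 0" for x y
    using affine_map_const[OF assms, of y x] by (simp add: dd_def)
  then have "f (x + y) = f x + (f y - f 0)" for x y by (metis add.commute diff_add_cancel)
  then show "additive_map (\<lambda>x. f x - f 0)" by (simp add: additive_map_def algebra_simps)
  show "f x = (f x - f 0) + f 0" for x by simp
qed

lemma quadratic_map_dd2: "quadratic_map f \<Longrightarrow> dd u (dd v f) x = dd u (dd v f) 0"
  unfolding quadratic_map_def by (metis affine_map_const)

lemma quadratic_map_dd2_add: "quadratic_map f \<Longrightarrow> dd (u + u') (dd v f) 0 = dd u (dd v f) 0 + dd u' (dd v f) 0"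
  by (simp add: dd_add quadratic_map_dd2[of f u v "u'"])

context frob_twist
begin

lemma dd_self: "dd v (dd v f) x = (0::'a)"
  by (simp add: dd_def add.assoc)

text \<open>For \<open>g(x, y) = C H(Cx) + C y\<^sup>\<sigma>\<close> with \<open>\<sigma>(y) = \<tau>(y)\<^sup>2\<close>, the lines given by \<open>x\<close> and \<open>z\<close> with \<open>C(x + z) = u = \<tau>(d) / d\<close> are
  skew for all \<open>y\<close>, \<open>w\<close> if and only if \<open>Tr (\<tau>(d) (H(X + u) + H(X))) = 1\<close> at \<open>X = Cx\<close>. The value \<open>0\<close> in place
  of \<open>1\<close> occurs for the derivatives of \<open>H\<close>.\<close>

definition slope_cond :: "'a \<Rightarrow> ('a \<Rightarrow> 'a) \<Rightarrow> bool" where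
  "slope_cond c f \<longleftrightarrow> (\<forall>d X. d \<noteq> 0 \<longrightarrow> Tr (T d * dd (T d / d) f X) = c)"

text \<open>The difference in direction \<open>v\<close> commutes with the slope difference, and the
  two equal traces cancel.\<close>

lemma slope_cond_dd: "slope_cond c f \<Longrightarrow> slope_cond 0 (dd v f)"
  unfolding slope_cond_def dd_commute[of _ v] by (simp add: dd_def[of v] distrib_left Tr_add)

lemma slope_cond_foldr_dd: "slope_cond c f \<Longrightarrow> \<exists>c. slope_cond c (foldr dd us f)"
  by (induction us) (auto dest: slope_cond_dd)

text \<open>For \<open>\<tau>(x) = x\<^sup>2\<close> the condition says that a cubic form is constant away from \<open>0\<close>. Its third derivative
  is trilinear and takes that constant on independent vectors, so in dimension at least \<open>4\<close> the constant is \<open>0\<close>.\<close>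

lemma slope_cond_square:
  assumes t: "t = 1" "4 \<le> e" and f: "quadratic_map f" "slope_cond c f" and c: "c = 0 \<or> c = 1"
  shows "c = 0 \<and> affine_map f"
proof -
  define B where "B u v = dd u (dd v f) 0" for u v
  have B_sym: "B u v = B v u" for u v by (simp add: B_def dd_commute[of u])
  have B_add: "B (u + u') v = B u v + B u' v" for u u' v
    by (simp add: B_def quadratic_map_dd2_add[OF f(1)])
  have B_add2: "B v (u + u') = B v u + B v u'" for u u' v
    using B_add B_sym by metis
  have B_self: "B v v = 0" for v by (simp add: B_def dd_self)
  have B_0: "B 0 v = 0" for v by (simp add: B_def dd_zero)
  have T: "T d = d\<^sup>2" for d unfolding T_def by (simp add: t)
  define g where "g u = f u + f 0" for u
  have g_add: "g (u + v) = g u + g v + B u v" for u v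
    by (simp add: g_def B_def dd_def ac_simps)
  define \<phi> where "\<phi> u = Tr (u\<^sup>2 * g u)" for u
  have phi: "\<phi> u = c" if "u \<noteq> 0" for u
  proof -
    have "Tr (T u * dd (T u / u) f 0) = c" using f(2) that by (simp add: slope_cond_def)
    then show ?thesis using that by (simp add: T \<phi>_def g_def dd_def power2_eq_square)
  qed
  have TrB_self: "Tr (u\<^sup>2 * B u v) = 0" for u v
  proof (cases "u = 0")
    case False
    have "Tr (T u * dd (T u / u) (dd v f) 0) = 0"
      using slope_cond_dd[OF f(2)] False by (simp add: slope_cond_def)
    then show ?thesis using False by (simp add: T B_def power2_eq_square)
  qed simp
  have N_sym: "Tr (x\<^sup>2 * B y z) = Tr (y\<^sup>2 * B x z)" for x y z
  proof -
    have "0 = Tr ((x + y)\<^sup>2 * B (x + y) z)" by (rule TrB_self[symmetric])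
    also have "\<dots> = Tr (x\<^sup>2 * B x z) + Tr (y\<^sup>2 * B y z) + (Tr (x\<^sup>2 * B y z) + Tr (y\<^sup>2 * B x z))"
      by (simp add: add_square B_add distrib_left distrib_right Tr_add ac_simps)
    finally have "Tr (x\<^sup>2 * B y z) + Tr (y\<^sup>2 * B x z) = 0" by (simp add: TrB_self)
    then show ?thesis by (simp add: add_eq_0)
  qed
  \<comment> \<open>Polarization of \<open>\<phi>\<close>: the seven values add up to
    \<open>7c = c\<close>, and the three mixed terms, being equal by symmetry, to one of
    them.\<close>
  have indep: "Tr (x\<^sup>2 * B y z) = c"
    if ne: "x \<noteq> 0" "y \<noteq> 0" "z \<noteq> 0" "x + y \<noteq> 0" "x + z \<noteq> 0" "y + z \<noteq> 0" "x + y + z \<noteq> 0" for x y z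
  proof -
    have "\<phi> (x + y + z) + \<phi> (x + y) + \<phi> (x + z) + \<phi> (y + z) + \<phi> x + \<phi> y + \<phi> z =
        Tr (x\<^sup>2 * B y z) + Tr (y\<^sup>2 * B x z) + Tr (z\<^sup>2 * B x y)"
      by (simp add: \<phi>_def g_add add_square B_add B_add2 distrib_left distrib_right Tr_add ac_simps)
    also have "Tr (y\<^sup>2 * B x z) = Tr (x\<^sup>2 * B y z)" by (rule N_sym)
    also have "Tr (z\<^sup>2 * B x y) = Tr (x\<^sup>2 * B y z)" by (metis N_sym B_sym)
    finally show ?thesis using ne by (simp add: phi ac_simps)
  qed
  have card16: "16 \<le> CARD('a)"
    using power_increasing[of 4 e "2::nat"] t(2) by (simp add: card)
  have avoid: "\<exists>x. x \<notin> A" if "card A \<le> 8" "finite A" for A :: "'a set"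
  proof (rule ccontr)
    assume "\<not> ?thesis"
    then have "A = UNIV" by blast
    with that card16 show False by simp
  qed
  define sp where "sp y z = {0, y, z, y + z :: 'a}" for y z
  have sp_iff: "x \<notin> sp y z \<longleftrightarrow> x \<noteq> 0 \<and> x + y \<noteq> 0 \<and> x + z \<noteq> 0 \<and> x + y + z \<noteq> 0" for x y z
    unfolding sp_def by (auto simp: add_eq_0 add.assoc)
  have indep': "Tr (x\<^sup>2 * B y z) = c" if "x \<notin> sp y z" "y \<noteq> 0" "z \<noteq> 0" "y + z \<noteq> 0" for x y z
    using that unfolding sp_iff by (intro indep) auto
  \<comment> \<open>Sixteen elements leave room for \<open>x\<close> and \<open>x'\<close> such that
    \<open>x\<close>, \<open>x'\<close> and \<open>x + x'\<close> avoid the span of \<open>1\<close>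
    and \<open>y\<close>. Additivity then gives \<open>c = c + c\<close>.\<close>
  have c0: "c = 0"
  proof -
    have "card {0::'a, 1} \<le> 8" by simp
    from avoid[OF this] obtain y :: 'a where y: "y \<noteq> 0" "1 + y \<noteq> 0" by (auto simp: add_eq_0)
    have "card (sp 1 y) \<le> 8" by (simp add: sp_def card_insert_if)
    from avoid[OF this] obtain x where x: "x \<notin> sp 1 y" by (auto simp: sp_def)
    have "card (sp 1 y \<union> (+) x ` sp 1 y) \<le> 8"
      by (rule order_trans[OF card_Un_le], rule order_trans[OF add_mono[OF order_refl card_image_le]])
        (auto simp: sp_def card_insert_if)
    from avoid[OF this] obtain x' where x': "x' \<notin> sp 1 y" "x' \<notin> (+) x ` sp 1 y" by (auto simp: sp_def)
    have "x + x' \<notin> sp 1 y"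
    proof
      assume "x + x' \<in> sp 1 y"
      then have "x + (x + x') \<in> (+) x ` sp 1 y" by blast
      with x'(2) show False by simp
    qed
    then have "c = Tr ((x + x')\<^sup>2 * B 1 y)" using indep' y by simp
    also have "\<dots> = Tr (x\<^sup>2 * B 1 y) + Tr (x'\<^sup>2 * B 1 y)" by (simp add: add_square distrib_right Tr_add)
    also have "\<dots> = c + c" using indep' x x' y by simp
    finally show ?thesis by simp
  qed
  have "B y z = 0" for y z
  proof (cases "y \<noteq> 0 \<and> z \<noteq> 0 \<and> y + z \<noteq> 0")
    case True
    have "Tr (x\<^sup>2 * B y z) = 0" for x
    proof (cases "x \<in> sp y z")
      case True
      have "Tr (z\<^sup>2 * B y z) = 0" using TrB_self[of z y] by (simp add: B_sym)
      then have "Tr ((y + z)\<^sup>2 * B y z) = 0" using TrB_self[of y z] by (simp add: add_square distrib_right Tr_add)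
      with True \<open>Tr (z\<^sup>2 * B y z) = 0\<close> TrB_self[of y z] show ?thesis by (auto simp: sp_def)
    next
      case False
      with indep' \<open>y \<noteq> 0 \<and> z \<noteq> 0 \<and> y + z \<noteq> 0\<close> c0 show ?thesis by blast
    qed
    moreover have "\<exists>w. w\<^sup>2 = x" for x :: 'a using frob_surj[of 1 x] by simp
    ultimately have "Tr (x * B y z) = 0" for x by metis
    then show ?thesis by (rule Tr_nondegenerate)
  next
    case False
    then show ?thesis using B_self B_0 B_sym by (auto simp: add_eq_0) (metis B_0 B_sym)
  qed
  then have "affine_map f" unfolding affine_map_def using quadratic_map_dd2[OF f(1)] by (metis B_def)
  with c0 show ?thesis by simp
qed

lemma S_not_id:
  assumes "t + 1 < e"
  shows "\<exists>x. S x \<noteq> x"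
proof (rule ccontr)
  assume "\<not> ?thesis"
  then have "e dvd Suc t" by (intro frob_id_dvd) (simp add: S_power)
  with assms show False by (auto dest: dvd_imp_le)
qed

text \<open>\<open>linear_twist_0\<close> describes \<open>B u v\<close> for fixed \<open>v\<close>
  by one coefficient \<open>a v\<close>. Symmetry with \<open>u = 1\<close> expresses
  \<open>T (a v)\<close> through \<open>a v\<close>, and then \<open>B v v = 0\<close> factors as
  \<open>(v + S v) * (a v + S v) = 0\<close>.\<close>

lemma quadratic_slope_cond:
  assumes f: "quadratic_map f" "slope_cond c f" and c: "c = 0 \<or> c = 1" and nonaffine: "\<not> affine_map f"
  shows "(\<forall>v. T (S v) = v) \<and> (\<forall>u v x. dd u (dd v f) x = u * S v + S u * v)"
proof -
  have t1: "\<not> (t = 1 \<and> 4 \<le> e)" using slope_cond_square[OF _ _ f c] nonaffine by blast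
  define B where "B u v = dd u (dd v f) 0" for u v
  have dd_B: "dd u (dd v f) x = B u v" for u v x unfolding B_def by (rule quadratic_map_dd2[OF f(1)])
  have B_sym: "B u v = B v u" for u v by (simp add: B_def dd_commute[of u])
  have B_add: "B (u + u') v = B u v + B u' v" for u u' v
    by (simp add: B_def quadratic_map_dd2_add[OF f(1)])
  have B_self: "B v v = 0" for v by (simp add: B_def dd_self)
  have B_ne: "\<exists>u v. B u v \<noteq> 0" using nonaffine by (auto simp: affine_map_def dd_B)
  have "\<exists>a b. (\<forall>u. B u v = a * u + b * S u) \<and> (t + 1 < e \<longrightarrow> b = T a)" for v
  proof -
    have "additive_map (\<lambda>u. B u v)" by (simp add: additive_map_def B_add)
    moreover have "Tr (T d * B (T d / d) v) = 0" if "d \<noteq> 0" for d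
      using slope_cond_dd[OF f(2), of v] that by (simp add: slope_cond_def B_def)
    ultimately show ?thesis by (rule linear_twist_0[OF t1]) auto
  qed
  then obtain a b where B_ab: "\<And>u v. B u v = a v * u + b v * S u" and b: "\<And>v. t + 1 < e \<Longrightarrow> b v = T (a v)"
    by metis
  have te: "t + 1 < e"
  proof (rule ccontr)
    assume "\<not> t + 1 < e"
    then have "Suc t = e" using t_less by simp
    then have S: "S u = u" for u by (simp add: S_power frob_e)
    have "a v + b v = 0" if "v \<noteq> 0" for v
      using B_self[of v] that by (simp add: B_ab S flip: distrib_right)
    then have "B u v = 0" if "v \<noteq> 0" for u v
      using that by (simp add: B_ab S flip: distrib_right)
    moreover have "B u 0 = 0" for u using B_sym[of u 0] by (simp add: B_ab[of 0])
    ultimately have "B u v = 0" for u v by metis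
    with B_ne show False by simp
  qed
  have B_a: "B u v = a v * u + T (a v) * S u" for u v using B_ab b[OF te] by simp
  obtain x0 where x0: "S x0 \<noteq> x0" using S_not_id[OF te] by blast
  have a_add: "a (v + w) = a v + a w" for v w
  proof -
    define \<delta> where "\<delta> = a (v + w) + (a v + a w)"
    have zero: "\<delta> * u + T \<delta> * S u = 0" for u
    proof -
      have "\<delta> * u + T \<delta> * S u = B u (v + w) + (B u v + B u w)"
        by (simp add: \<delta>_def B_a algebra_simps)
      then show ?thesis by (simp add: B_sym[of u] B_add)
    qed
    \<comment> \<open>At \<open>u = 1\<close> the relation says that \<open>T\<close> fixes
      \<open>\<delta>\<close>; a point moved by \<open>S\<close> then excludes
      \<open>\<delta> = 1\<close>.\<close>
    from zero[of 1] have "\<delta> = 0 \<or> \<delta> = 1" by (simp add: add_eq_0 flip: T_eq_self)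
    moreover have "\<delta> \<noteq> 1" using zero[of x0] x0 by (auto simp: add_eq_0)
    ultimately show ?thesis by (simp add: \<delta>_def add_eq_0)
  qed
  have Ta: "T (a v) = a v + a 1 * v + T (a 1) * S v" for v
  proof -
    have "a v + T (a v) = a 1 * v + T (a 1) * S v"
      using B_sym[of 1 v] by (simp add: B_a)
    then show ?thesis by (metis add.assoc add_self_left)
  qed
  have "a 1 = 0 \<or> a 1 = 1" using B_self[of 1] by (simp add: B_a add_eq_0 flip: T_eq_self)
  moreover have "a 1 \<noteq> 0"
  proof
    assume a1: "a 1 = 0"
    have a01: "a v = 0 \<or> a v = 1" for v using Ta[of v] by (simp add: a1 T_eq_self)
    have "a v = 0" for v
    proof (rule ccontr)
      assume "a v \<noteq> 0"
      then have av: "a v = 1" using a01 by blast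
      then have Sv: "S v = v" using B_self[of v] by (simp add: B_a add_eq_0)
      have "B u v = B v u" for u by (rule B_sym)
      then have "u + S u = a u * v + T (a u) * v" for u by (simp add: B_a av Sv)
      then have "u + S u = 0" for u using a01[of u] by (metis T_eq_self add_self)
      with x0 show False by (simp add: add_eq_0)
    qed
    then have "B u v = 0" for u v by (simp add: B_a)
    with B_ne show False by simp
  qed
  ultimately have a1: "a 1 = 1" by blast
  have a_S: "a v = S v" if "S v \<noteq> v" for v
  proof -
    have "(v + S v) * (a v + S v) = a v * v + T (a v) * S v"
      by (simp add: Ta[of v] a1 algebra_simps)
    also have "\<dots> = 0" using B_self[of v] by (simp add: B_a)
    finally show ?thesis using that by (auto simp: add_eq_0)
  qed
  have a_S': "a v = S v" for v
  proof (cases "S v = v")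
    case True
    \<comment> \<open>A fixed point of \<open>S\<close> is the sum of two points moved by
      \<open>S\<close>, so additivity of \<open>a\<close> settles it.\<close>
    then have "S (v + x0) \<noteq> v + x0" using x0 by simp
    from a_S[OF this] a_S[OF x0] show ?thesis by (simp add: a_add)
  qed (rule a_S)
  have TS: "T (S v) = v" for v using Ta[of v] by (simp add: a1 a_S' ac_simps)
  have "dd u (dd v f) x = u * S v + S u * v" for u v x
    using B_a[of u v] by (simp add: dd_B a_S' TS ac_simps)
  with TS show ?thesis by blast
qed

text \<open>If the degree were higher, then some derivative \<open>dd z K\<close> would be quadratic with the polar form of
  \<open>quadratic_slope_cond\<close>, which however vanishes at \<open>(z, y)\<close> because \<open>dd z (dd z K) = 0\<close>.\<close>

lemma slope_cond_quadratic:
  assumes "slope_cond 1 (poly p)"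
  shows "quadratic_map (poly p)"
proof -
  define vanish where "vanish n \<longleftrightarrow> (\<forall>us x. length us = n \<longrightarrow> foldr dd us (poly p) x = 0)" for n
  have "vanish (Suc (degree p))" by (simp add: vanish_def foldr_dd_poly)
  define n where "n = (LEAST n. vanish n)"
  have n: "vanish n" unfolding n_def by (rule LeastI) fact
  have least: "\<not> vanish m" if "m < n" for m using not_less_Least that unfolding n_def by blast
  have "n \<le> 3"
  proof (rule ccontr)
    assume "\<not> n \<le> 3"
    then obtain m where m: "n = Suc (Suc (Suc (Suc m)))"
      by (metis Suc_le_D not_less_eq_eq numeral_3_eq_3)
    have "\<not> vanish (Suc (Suc (Suc m)))" by (rule least) (simp add: m)
    then obtain us x where us: "length us = Suc (Suc (Suc m))" "foldr dd us (poly p) x \<noteq> 0"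
      by (auto simp: vanish_def)
    then obtain u v z vs where us_eq: "us = u # v # z # vs" "length vs = m"
      by (auto simp: length_Suc_conv)
    define K where "K = foldr dd vs (poly p)"
    obtain c where "slope_cond c K" using slope_cond_foldr_dd[OF assms] by (auto simp: K_def)
    then have cond: "slope_cond 0 (dd z K)" by (rule slope_cond_dd)
    have "dd a (dd b (dd c (dd z K))) y = 0" for a b c y
      using n[unfolded vanish_def, rule_format, of "a # b # c # z # vs" y] us_eq(2) by (simp add: m K_def)
    then have quad: "quadratic_map (dd z K)" by (simp add: quadratic_map_def affine_map_def)
    have nz: "dd u (dd v (dd z K)) x \<noteq> 0" using us by (simp add: us_eq K_def)
    then have "\<not> affine_map (dd z K)" by (auto simp: affine_map_def)
    from quadratic_slope_cond[OF quad cond _ this]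
    have B: "dd u (dd v (dd z K)) x = u * S v + S u * v" for u v x by simp
    have "z * S y + S z * y = 0" for y
    proof -
      have "dd z (dd y (dd z K)) 0 = dd y (dd z (dd z K)) 0" by (simp only: dd_commute[of z y])
      also have "\<dots> = 0" by (simp add: dd_def[of y] dd_self)
      finally show ?thesis by (simp only: B)
    qed
    note zero = this
    have "z \<noteq> 0"
    proof
      assume "z = 0"
      then have "dd z K = (\<lambda>_. 0)" by (auto simp: dd_zero)
      with nz show False by (simp add: dd_def)
    qed
    from zero[of 1] have Sz: "S z = z" by (simp add: add_eq_0)
    have "S y = y" for y
    proof -
      have "z * (S y + y) = 0" using zero[of y] by (simp add: Sz distrib_left)
      with \<open>z \<noteq> 0\<close> show ?thesis by (simp add: add_eq_0)
    qed
    then have "dd u (dd v (dd z K)) x = 0" by (simp add: B)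
    with nz show False by simp
  qed
  have mono: "vanish m'" if "vanish m" "m \<le> m'" for m m'
    using that(2,1)
  proof (induction rule: dec_induct)
    case (step m')
    show ?case unfolding vanish_def
    proof (intro allI impI)
      fix us :: "'a list" and x assume "length us = Suc m'"
      then obtain u vs where "us = u # vs" "length vs = m'" by (auto simp: length_Suc_conv)
      with step show "foldr dd us (poly p) x = 0" by (simp add: vanish_def dd_def)
    qed
  qed
  have v3: "vanish 3" by (rule mono[OF n \<open>n \<le> 3\<close>])
  have "dd a (dd b (dd c (poly p))) y = 0" for a b c y
    using v3[unfolded vanish_def, rule_format, of "[a, b, c]" y] by simp
  then show ?thesis by (simp add: quadratic_map_def affine_map_def)
qed

text \<open>In both cases a particular solution of the trace condition is split off, so that
  \<open>linear_twist_0\<close> applies to the rest: \<open>k * u\<close> with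
  \<open>Tr k = 1\<close> in the affine case, \<open>x * S x\<close> otherwise.\<close>

theorem slope_cond_classification:
  assumes "slope_cond 1 (poly p)"
  shows "t + 1 = e \<and> (\<exists>c b. \<forall>x. poly p x = c * x + b) \<or>
    e = 2 * t + 1 \<and> (\<exists>a b. \<forall>x. poly p x = x * S x + a * x + T a * S x + b)"
proof -
  define f where "f = poly p"
  have cond: "slope_cond 1 f" using assms by (simp add: f_def)
  have quad: "quadratic_map f" unfolding f_def by (rule slope_cond_quadratic[OF assms])
  have t1: "\<not> (t = 1 \<and> 4 \<le> e)" using slope_cond_square[OF _ _ quad cond] by auto
  show ?thesis
  proof (cases "affine_map f")
    case True
    from affine_mapE[OF this] obtain L where L: "additive_map L" "\<And>x. f x = L x + f 0" by blast
    have TrL: "Tr (T d * L (T d / d)) = 1" if "d \<noteq> 0" for d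
    proof -
      have "dd (T d / d) f 0 = L (T d / d)"
        unfolding dd_def by (subst (1 2) L(2)) (simp add: additive_0[OF L(1)] add.assoc)
      moreover have "Tr (T d * dd (T d / d) f 0) = 1" using cond that unfolding slope_cond_def by blast
      ultimately show ?thesis by metis
    qed
    have te: "t + 1 = e" by (rule linear_twist_1[OF t1 L(1) TrL])
    then have S: "S u = u" for u by (simp add: S_power frob_e)
    obtain k where k: "Tr k = 1" using ex_Tr_1 by blast
    have add: "additive_map (\<lambda>u. L u + k * u)" by (simp add: additive_map_def additive_mapD[OF L(1)] algebra_simps)
    have zero: "Tr (T d * (L (T d / d) + k * (T d / d))) = 0" if "d \<noteq> 0" for d
    proof -
      have "(T d)\<^sup>2 = d" using S[of d] by (simp add: S_def)
      then have "T d * (k * (T d / d)) = k" using that by (simp add: power2_eq_square field_simps)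
      then show ?thesis using TrL[OF that] k by (simp add: distrib_left Tr_add)
    qed
    obtain a b where ab: "\<And>u. L u + k * u = a * u + b * S u"
    proof (rule linear_twist_0[OF t1 add zero])
      fix a b assume "\<And>u. L u + k * u = a * u + b * S u"
      then show thesis by (rule that)
    qed
    have "L u = (a + b + k) * u" for u
      using ab[of u] by (metis S add.assoc add.commute add_self_left distrib_right)
    then have "f x = (a + b + k) * x + f 0" for x using L(2) by metis
    with te show ?thesis unfolding f_def by blast
  next
    case False
    from quadratic_slope_cond[OF quad cond _ False]
    have TS: "\<And>v. T (S v) = v" and B: "\<And>u v x. dd u (dd v f) x = u * S v + S u * v" by auto
    \<comment> \<open>\<open>T (S x) = x\<close> makes \<open>2 * t + 1\<close> a multiple of
      \<open>e\<close>, and \<open>t < e\<close> leaves only \<open>e\<close> itself.\<close>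
    have "x ^ 2 ^ (2 * t + 1) = x" for x :: 'a
    proof -
      have "x ^ 2 ^ (Suc t + t) = T (S x)" unfolding T_def S_power by (simp only: power_add power_mult)
      moreover have "Suc t + t = 2 * t + 1" by simp
      ultimately show ?thesis using TS[of x] by (simp only:)
    qed
    then have "e dvd 2 * t + 1" by (rule frob_id_dvd)
    then obtain k where k: "2 * t + 1 = e * k" by (elim dvdE)
    have "k = 1"
    proof -
      have "k \<noteq> 0" using k by (intro notI) simp
      moreover have "\<not> 2 \<le> k"
      proof
        assume "2 \<le> k"
        then have "e * 2 \<le> e * k" by (rule mult_left_mono) simp
        with k t_less show False by simp
      qed
      ultimately show ?thesis by simp
    qed
    with k have e: "e = 2 * t + 1" by simp
    \<comment> \<open>\<open>Q\<close> has the second differences of \<open>f\<close>, and it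
      contributes \<open>Tr 1\<close> to the slope condition, which is \<open>1\<close> because
      \<open>e\<close> is odd.\<close>
    define Q where "Q x = x * S x" for x
    have ddQ: "dd u Q x = x * S u + u * S x + u * S u" for u x
      by (simp add: dd_def Q_def algebra_simps)
    have "affine_map (\<lambda>x. f x + Q x)"
    proof -
      have "dd u (dd v (\<lambda>x. f x + Q x)) x = dd u (dd v f) x + dd u (dd v Q) x" for u v x
        by (simp add: dd_def ac_simps)
      moreover have "dd u (dd v Q) x = u * S v + S u * v" for u v x
        unfolding dd_def[of u] ddQ by (simp add: algebra_simps)
      ultimately show ?thesis by (simp add: affine_map_def B)
    qed
    from affine_mapE[OF this] obtain L where L: "additive_map L" "\<And>x. f x + Q x = L x + (f 0 + Q 0)" by blast
    have f: "f x = Q x + L x + f 0" for x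
      using L(2)[of x] by (metis Q_def add.assoc add.commute add_self_left mult_zero_left add.right_neutral)
    have "Tr (T d * L (T d / d)) = 0" if d: "d \<noteq> 0" for d
    proof -
      define U where "U = T d / d"
      have U: "T d = U * d" "U \<noteq> 0" using d by (auto simp: U_def)
      have "T (T d * T d) = d" using TS[of d] by (simp add: S_def power2_eq_square)
      then have "S U = d / (T d * T d)" by (simp add: U_def S_def power2_eq_square)
      then have "T d * (U * S U) = 1" using d by (simp add: U_def)
      moreover have "dd U f 0 = U * S U + L U"
      proof -
        have "dd U f 0 = Q U + (L U + (Q 0 + L 0))"
          unfolding dd_def by (subst (1 2) f) (simp add: ac_simps)
        then show ?thesis by (simp add: Q_def additive_0[OF L(1)])
      qed
      moreover have "Tr (T d * dd U f 0) = 1" using cond d unfolding slope_cond_def U_def by blast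
      ultimately have "Tr 1 + Tr (T d * L U) = 1" by (simp add: distrib_left Tr_add)
      moreover have "Tr 1 = 1"
      proof -
        have "Tr 1 = of_nat e" by (simp add: Tr_def)
        also have "\<dots> = 1" by (subst e) (simp add: two)
        finally show ?thesis .
      qed
      ultimately have "Tr (T d * L U) = 0" by (metis add_left_cancel add.right_neutral)
      then show ?thesis by (simp add: U_def)
    qed
    from linear_twist_0[OF t1 L(1) this] obtain a b where
      ab: "\<And>u. L u = a * u + b * S u" "t + 1 < e \<Longrightarrow> b = T a" by blast
    show ?thesis
    proof (cases "t + 1 < e")
      case True
      then have "f x = x * S x + a * x + T a * S x + f 0" for x
        using f[of x] ab by (simp add: Q_def ac_simps)
      with e show ?thesis unfolding f_def by blast
    next
      case False
      then have "t = 0" using e t_less by auto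
      then have x01: "x = 0 \<or> x = 1" for x :: 'a using fixed_point[of x] by simp
      have "S x = x" for x using x01[of x] by auto
      then have "dd u (dd v f) x = 0" for u v x by (simp add: B ac_simps)
      with \<open>\<not> affine_map f\<close> show ?thesis by (simp add: affine_map_def)
    qed
  qed
qed

end

section \<open>Spreads\<close>

lemma in_span_pair: "w \<in> vec.span {u, v} \<longleftrightarrow> (\<exists>a b. w = a *s u + b *s (v :: 'a::field ^ 'n))"
proof
  assume "w \<in> vec.span {u, v}"
  then obtain a where "w - a *s u \<in> vec.span {v}" by (auto simp: vec.span_insert)
  then obtain b where "w - a *s u = b *s v" by (auto simp: vec.span_singleton)
  then have "w = a *s u + b *s v" by (simp add: diff_eq_eq add.commute)
  then show "\<exists>a b. w = a *s u + b *s v" by blast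
next
  assume "\<exists>a b. w = a *s u + b *s v"
  then show "w \<in> vec.span {u, v}" by (auto intro!: vec.span_add vec.span_scale intro: vec.span_base)
qed

lemma in_span_single: "w \<in> vec.span {v} \<longleftrightarrow> (\<exists>a. w = a *s (v :: 'a::field ^ 'n))"
  by (auto simp: vec.span_singleton)

lemma dim_span_pair:
  fixes u v :: "'a::field ^ 'n"
  assumes "v \<noteq> 0" "u \<notin> vec.span {v}"
  shows "vec.dim (vec.span {u, v}) = 2"
proof -
  have "vec.dim {u, v} = vec.dim {v} + 1" using assms(2) by (simp only: vec.dim_insert if_False)
  also have "vec.dim {v} = 1" using assms(1) by simp
  finally show ?thesis by simp
qed

lemma span_in_pg_points: "v \<noteq> 0 \<Longrightarrow> vec.span {v} \<in> pg_points"
  by (simp add: pg_points_def)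

lemma pg_points_eq_span:
  assumes "P \<in> pg_points"
  obtains v where "v \<noteq> 0" "v \<in> P" "P = vec.span {v}"
proof -
  have P: "vec.subspace P" "vec.dim P = 1" using assms by (auto simp: pg_points_def)
  have "\<not> P \<subseteq> {0}"
  proof
    assume "P \<subseteq> {0}"
    then have "vec.dim P \<le> vec.dim {0 :: 'a ^ 4}" by (rule vec.dim_subset)
    with P show False by simp
  qed
  then obtain v where v: "v \<in> P" "v \<noteq> 0" by blast
  then have "vec.span {v} \<subseteq> P" using P by (intro vec.span_minimal) auto
  then have "vec.span {v} = P" using P v by (intro vec.subspace_dim_equal) auto
  with v that show thesis by blast
qed

lemma span_in_pg_flat: "v \<noteq> 0 \<Longrightarrow> v \<in> U \<Longrightarrow> vec.subspace U \<Longrightarrow> vec.span {v} \<in> pg_flat U"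
  unfolding pg_flat_def by (auto intro: span_in_pg_points dest: vec.span_minimal[rotated] vec.subspace_scale simp: in_span_single)

lemma pg_flat_meetE:
  assumes "pg_flat U \<inter> pg_flat V \<noteq> {}"
  obtains v where "v \<noteq> 0" "v \<in> U" "v \<in> V"
proof -
  obtain P where "P \<in> pg_points" "P \<subseteq> U" "P \<subseteq> V" using assms by (auto simp: pg_flat_def)
  then show thesis using that by (metis pg_points_eq_span subsetD)
qed

lemma pg_flat_meetI:
  assumes "v \<noteq> 0" "v \<in> U" "v \<in> V" "vec.subspace U" "vec.subspace V"
  shows "pg_flat U \<inter> pg_flat V \<noteq> {}"
proof -
  have "vec.span {v} \<in> pg_flat U \<inter> pg_flat V" using assms by (intro IntI span_in_pg_flat)
  then show ?thesis by blast
qed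

lemma spread_disjoint: "spread S \<Longrightarrow> l \<in> S \<Longrightarrow> m \<in> S \<Longrightarrow> l \<inter> m \<noteq> {} \<Longrightarrow> l = m"
  unfolding spread_def partition_on_def disjoint_def by blast

lemma vec4_eq_iff: "(x :: 'a ^ 4) = y \<longleftrightarrow> x$1 = y$1 \<and> x$2 = y$2 \<and> x$3 = y$3 \<and> x$4 = y$4"
  by (simp add: vec_eq_iff forall_4)

text \<open>If the expression vanishes, the two lines share the point with \<open>x\<^sub>0 = x - z\<close> and \<open>x\<^sub>1 = y - w\<close>.\<close>

lemma spread_of_cond:
  fixes g :: "'a::field \<Rightarrow> 'a \<Rightarrow> 'a"
  assumes S: "spread (spread_of g)" and ne: "(x, y) \<noteq> (z, w)"
  shows "(x - z) * (g x y - g z w) + (y - w)\<^sup>2 \<noteq> 0"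
proof
  assume 0: "(x - z) * (g x y - g z w) + (y - w)\<^sup>2 = 0"
  define r s where "r = x - z" and "s = y - w"
  define u v u' v' :: "'a ^ 4" where "u = vector [0, 1, x, y]" and "v = vector [1, 0, - y, g x y]"
    and "u' = vector [0, 1, z, w]" and "v' = vector [1, 0, - w, g z w]"
  define l m where "l = line_through u v" and "m = line_through u' v'"
  have lm: "l \<in> spread_of g" "m \<in> spread_of g"
    unfolding l_def m_def u_def v_def u'_def v'_def spread_of_def by blast+
  define k where "k = s *s u + r *s v"
  have "r * (g x y - g z w) + s * s = 0" using 0 by (simp add: r_def s_def power2_eq_square)
  then have "s * y + r * g x y = s * w + r * g z w" by (simp add: s_def algebra_simps)
  then have k: "k = s *s u' + r *s v'"
    by (simp add: k_def u_def v_def u'_def v'_def vec4_eq_iff) (simp add: r_def s_def algebra_simps)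
  have "k \<noteq> 0"
  proof
    assume "k = 0"
    then have "s = 0" "r = 0" by (simp_all add: k_def u_def v_def vec4_eq_iff)
    with ne show False by (simp add: r_def s_def)
  qed
  moreover have "k \<in> vec.span {u, v}" unfolding in_span_pair k_def by blast
  moreover have "k \<in> vec.span {u', v'}" unfolding in_span_pair using k by blast
  ultimately have "l \<inter> m \<noteq> {}" unfolding l_def m_def line_through_def
    by (rule pg_flat_meetI) auto
  then have "l = m" using spread_disjoint[OF S lm] by blast
  have "u' \<noteq> 0" by (simp add: u'_def vec4_eq_iff)
  then have "vec.span {u'} \<in> l"
    unfolding \<open>l = m\<close> m_def line_through_def by (rule span_in_pg_flat) (auto intro: vec.span_base)
  then have "u' \<in> vec.span {u, v}"
    unfolding l_def line_through_def pg_flat_def by (auto intro: vec.span_base)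
  then obtain a b where "u' = a *s u + b *s v" by (auto simp: in_span_pair)
  then show False using ne by (auto simp: u_def v_def u'_def vec4_eq_iff)
qed

lemma span_pair_eq:
  fixes w1 w2 :: "'a::field ^ 'n"
  assumes "vec.subspace K" "vec.dim K = 2" "w1 \<in> K" "w2 \<in> K" "w2 \<noteq> 0" "w1 \<notin> vec.span {w2}"
  shows "K = vec.span {w1, w2}"
proof -
  have "vec.span {w1, w2} \<subseteq> K" using assms by (intro vec.span_minimal) auto
  then have "vec.span {w1, w2} = K"
    using assms dim_span_pair[OF assms(5,6)] by (intro vec.subspace_dim_equal) auto
  then show ?thesis by simp
qed

text \<open>An endomorphism \<open>J\<close> without eigenvectors that leaves all lines of the spread invariant makes these
  lines the planes \<open>\<langle>w, Jw\<rangle>\<close>. If \<open>v = m + n\<close> with \<open>m\<close>, \<open>n\<close> on two of the lines, then \<open>Jv = Jm + Jn\<close>, so a line of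
  the regulus meets \<open>\<langle>m, n\<rangle>\<close>, \<open>\<langle>Jm, Jn\<rangle>\<close> and \<open>\<langle>m + Jm, n + Jn\<rangle>\<close>, which forces it to be \<open>J\<close>-invariant.\<close>

lemma regular_spreadI:
  fixes J :: "'a::field ^ 4 \<Rightarrow> 'a ^ 4"
  assumes S: "spread S" and J: "Vector_Spaces.linear (*s) (*s) J"
    and inv: "\<And>U. vec.subspace U \<Longrightarrow> vec.dim U = 2 \<Longrightarrow> pg_flat U \<in> S \<Longrightarrow> J ` U \<subseteq> U"
    and no_eigen: "\<And>v c. J v = c *s v \<Longrightarrow> v = 0"
  shows "regular_spread S"
  unfolding regular_spread_def
proof (intro conjI ballI impI subsetI S)
  fix l m n k
  assume lmn: "l \<in> S" "m \<in> S" "n \<in> S" and ne: "l \<noteq> m \<and> l \<noteq> n \<and> m \<noteq> n" and k: "k \<in> regulus l m n"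
  have J_add: "J (x + y) = J x + J y" and J_scale: "J (c *s x) = c *s J x" for x y c
    using J by (auto simp: Vector_Spaces.linear_iff)
  have flat: "\<exists>U. l = pg_flat U \<and> vec.subspace U \<and> vec.dim U = 2" if "l \<in> pg_lines" for l :: "('a ^ 4) set set"
    using that by (auto simp: pg_lines_def)
  have lines: "S \<subseteq> pg_lines" using S by (simp add: spread_def)
  obtain U where U: "l = pg_flat U" "vec.subspace U" "vec.dim U = 2" using flat lmn(1) lines by blast
  obtain V where V: "m = pg_flat V" "vec.subspace V" "vec.dim V = 2" using flat lmn(2) lines by blast
  obtain W where W: "n = pg_flat W" "vec.subspace W" "vec.dim W = 2" using flat lmn(3) lines by blast
  have "k \<in> pg_lines" using k by (simp add: regulus_def)
  then obtain K where K: "k = pg_flat K" "vec.subspace K" "vec.dim K = 2" using flat by blast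
  have JU: "J x \<in> U" if "x \<in> U" for x using inv[OF U(2,3)] lmn(1) that by (auto simp: U(1))
  have JV: "J x \<in> V" if "x \<in> V" for x using inv[OF V(2,3)] lmn(2) that by (auto simp: V(1))
  have JW: "J x \<in> W" if "x \<in> W" for x using inv[OF W(2,3)] lmn(3) that by (auto simp: W(1))
  have meet: "x = 0" if "l1 \<in> S" "l2 \<in> S" "l1 \<noteq> l2" "l1 = pg_flat A" "l2 = pg_flat B"
    "vec.subspace A" "vec.subspace B" "x \<in> A" "x \<in> B" for l1 l2 A B x
    using spread_disjoint[OF S that(1,2)] pg_flat_meetI[of x A B] that by blast
  have UV: "x = 0" if "x \<in> U" "x \<in> V" for x using meet lmn ne U V that by blast
  have UW: "x = 0" if "x \<in> U" "x \<in> W" for x using meet lmn ne U W that by blast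
  have VW: "x = 0" if "x \<in> V" "x \<in> W" for x using meet lmn ne V W that by blast
  have nonzero: "\<exists>x. x \<in> A \<and> x \<noteq> 0" if "vec.dim A = 2" for A :: "('a ^ 4) set"
  proof (rule ccontr)
    assume "\<not> ?thesis"
    then have "A \<subseteq> {0}" by blast
    then have "vec.dim A \<le> vec.dim {0 :: 'a ^ 4}" by (rule vec.dim_subset)
    with that show False by simp
  qed
  have J0: "J x \<notin> vec.span {x}" if "x \<noteq> 0" for x using no_eigen that by (auto simp: in_span_single)
  have indJ: "a = 0 \<and> b = 0" if "a *s x + b *s J x = 0" "x \<noteq> 0" for a b x
  proof -
    have "b = 0"
    proof (rule ccontr)
      assume b: "b \<noteq> 0"
      have "b *s J x = (- a) *s x" using that(1) by (simp add: eq_neg_iff_add_eq_0 add.commute)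
      then have "(1 / b) *s (b *s J x) = (1 / b) *s ((- a) *s x)" by simp
      then have "J x = (- a / b) *s x" using b by (simp add: vector_smult_assoc)
      with no_eigen that(2) show False by blast
    qed
    with that show ?thesis by simp
  qed
  \<comment> \<open>\<open>V\<close> and \<open>W\<close> contain the planes spanned by
    \<open>x\<close>, \<open>J x\<close> and by \<open>y\<close>, \<open>J y\<close>; as they meet
    only in \<open>0\<close>, these four vectors form a basis.\<close>
  have decomp: "\<exists>x\<in>V. \<exists>y\<in>W. v = x + y" for v
  proof -
    obtain x where x: "x \<in> V" "x \<noteq> 0" using nonzero V by blast
    obtain y where y: "y \<in> W" "y \<noteq> 0" using nonzero W by blast
    have "vec.span {J y, y} \<subseteq> W" using y JW W by (intro vec.span_minimal) auto
    have "vec.dim {J y, y} = 2" using J0[OF y(2)] y(2) by (simp add: vec.dim_insert)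
    moreover have "x \<notin> vec.span {J y, y}" using \<open>_ \<subseteq> W\<close> x VW by blast
    moreover have "J x \<notin> vec.span {x, J y, y}"
    proof
      assume "J x \<in> vec.span {x, J y, y}"
      then obtain c where "J x - c *s x \<in> vec.span {J y, y}" by (auto simp: vec.span_insert)
      then have "J x - c *s x \<in> W" using \<open>_ \<subseteq> W\<close> by blast
      moreover have "J x - c *s x \<in> V" using x JV V by (intro vec.subspace_diff vec.subspace_scale) auto
      ultimately have "J x = c *s x" using VW by fastforce
      with no_eigen x show False by blast
    qed
    ultimately have "vec.dim {J x, x, J y, y} = 4" by (simp add: vec.dim_insert)
    then have "vec.span {J x, x, J y, y} = UNIV"
      using vec.dim_eq_full[of "{J x, x, J y, y}"] by (simp add: vec.dimension_def card_cart_basis)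
    then have "v \<in> vec.span {J x, x, J y, y}" by simp
    then obtain a where "v - a *s J x \<in> vec.span {x, J y, y}" by (auto simp: vec.span_insert[of "J x"])
    then obtain b where b: "v - a *s J x - b *s x \<in> vec.span {J y, y}" by (auto simp: vec.span_insert[of x])
    have "a *s J x + b *s x \<in> V" using x JV V by (intro vec.subspace_add vec.subspace_scale) auto
    moreover have "v - a *s J x - b *s x \<in> W" using b \<open>_ \<subseteq> W\<close> by blast
    moreover have "v = (a *s J x + b *s x) + (v - a *s J x - b *s x)" by simp
    ultimately show ?thesis by blast
  qed
  obtain v where v: "v \<in> U" "v \<noteq> 0" using nonzero U by blast
  obtain x y where x: "x \<in> V" and y: "y \<in> W" and vxy: "v = x + y" using decomp by blast
  have "x \<noteq> 0" using v y vxy UW by auto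
  have "y \<noteq> 0" using v x vxy UV by auto
  have hit: "\<exists>a b. a *s x' + b *s y' \<in> K \<and> a *s x' + b *s y' \<noteq> 0"
    if "x' \<in> V" "y' \<in> W" "x' + y' \<in> U" "x' + y' \<noteq> 0" for x' y'
  proof -
    have "x' \<noteq> 0" using that UW by auto
    have "y' \<noteq> 0" using that UV by auto
    have "x' \<notin> vec.span {y'}"
      using VW that(1,2) \<open>x' \<noteq> 0\<close> W(2) by (metis in_span_single vec.subspace_scale)
    then have "vec.dim (vec.span {x', y'}) = 2" using \<open>y' \<noteq> 0\<close> by (intro dim_span_pair)
    then have "pg_flat (vec.span {x', y'}) \<in> pg_lines" by (auto simp: pg_lines_def)
    moreover have "pg_flat (vec.span {x', y'}) \<inter> l \<noteq> {}"
      unfolding U(1) by (rule pg_flat_meetI[of "x' + y'"])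
        (use that U in \<open>auto intro: vec.span_add vec.span_base\<close>)
    moreover have "pg_flat (vec.span {x', y'}) \<inter> m \<noteq> {}"
      unfolding V(1) by (rule pg_flat_meetI[OF \<open>x' \<noteq> 0\<close>]) (use that V in \<open>auto intro: vec.span_base\<close>)
    moreover have "pg_flat (vec.span {x', y'}) \<inter> n \<noteq> {}"
      unfolding W(1) by (rule pg_flat_meetI[OF \<open>y' \<noteq> 0\<close>]) (use that W in \<open>auto intro: vec.span_base\<close>)
    ultimately have "k \<inter> pg_flat (vec.span {x', y'}) \<noteq> {}"
      using k by (auto simp: regulus_def transversals_def)
    then obtain p where "p \<noteq> 0" "p \<in> K" "p \<in> vec.span {x', y'}"
      unfolding K(1) by (rule pg_flat_meetE)
    then show ?thesis by (auto simp: in_span_pair)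
  qed
  have JvU: "J v \<in> U" using JU v by blast
  obtain a b where w1: "a *s x + b *s y \<in> K" "a *s x + b *s y \<noteq> 0"
    using hit[OF x y] v vxy by auto
  have "J v \<noteq> 0" using no_eigen[of v 0] v by auto
  then obtain c d where w2: "c *s J x + d *s J y \<in> K" "c *s J x + d *s J y \<noteq> 0"
    using hit[OF JV[OF x] JW[OF y]] JvU vxy by (auto simp: J_add)
  have "v + J v \<noteq> 0" using indJ[of 1 v 1] v by auto
  moreover have "v + J v \<in> U" using v(1) JvU U(2) by (intro vec.subspace_add)
  moreover have "(x + J x) + (y + J y) = v + J v" by (simp add: vxy J_add ac_simps)
  moreover have "x + J x \<in> V" "y + J y \<in> W" using x y JV JW V(2) W(2) by (auto intro: vec.subspace_add)
  ultimately obtain f h where w3: "f *s (x + J x) + h *s (y + J y) \<in> K" "f *s (x + J x) + h *s (y + J y) \<noteq> 0"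
    using hit[of "x + J x" "y + J y"] by auto
  have ind: "a1 = 0 \<and> a2 = 0 \<and> b1 = 0 \<and> b2 = 0" if "a1 *s x + a2 *s J x + b1 *s y + b2 *s J y = 0" for a1 a2 b1 b2
  proof -
    have eq: "a1 *s x + a2 *s J x = - (b1 *s y + b2 *s J y)"
      using that by (simp only: eq_neg_iff_add_eq_0 add.assoc)
    have "a1 *s x + a2 *s J x \<in> V" using x JV V by (intro vec.subspace_add vec.subspace_scale) auto
    moreover have "- (b1 *s y + b2 *s J y) \<in> W"
      using y JW W by (intro vec.subspace_neg vec.subspace_add vec.subspace_scale) auto
    ultimately have "a1 *s x + a2 *s J x = 0" unfolding eq by (intro VW)
    moreover from this have "b1 *s y + b2 *s J y = 0" unfolding eq by (simp only: neg_equal_0_iff_equal)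
    ultimately show ?thesis using indJ \<open>x \<noteq> 0\<close> \<open>y \<noteq> 0\<close> by blast
  qed
  define w where "w = a *s x + b *s y"
  have Jw: "J w = a *s J x + b *s J y" by (simp add: w_def J_add J_scale)
  have "w \<notin> vec.span {c *s J x + d *s J y}"
  proof
    assume "w \<in> vec.span {c *s J x + d *s J y}"
    then obtain q where "w = q *s (c *s J x + d *s J y)" by (auto simp: in_span_single)
    then have "a *s x + (- q * c) *s J x + b *s y + (- q * d) *s J y = 0"
      by (simp add: w_def vec_eq_iff algebra_simps)
    from ind[OF this] w1 show False by simp
  qed
  then have Kspan: "K = vec.span {w, c *s J x + d *s J y}"
    using K w1 w2 by (intro span_pair_eq) (auto simp: w_def)
  then obtain A B where AB: "f *s (x + J x) + h *s (y + J y) = A *s w + B *s (c *s J x + d *s J y)"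
    using w3(1) by (auto simp: in_span_pair)
  have "(f - A * a) *s x + (f - B * c) *s J x + (h - A * b) *s y + (h - B * d) *s J y = 0"
    using AB by (simp add: w_def vec_eq_iff algebra_simps)
  \<comment> \<open>The point on the third transversal makes \<open>(a, b)\<close> and
    \<open>(c, d)\<close> proportional, so \<open>J w\<close> is a multiple of the point of
    \<open>K\<close> on the second one.\<close>
  from ind[OF this] have fh: "f = A * a" "f = B * c" "h = A * b" "h = B * d" by auto
  have "f \<noteq> 0 \<or> h \<noteq> 0" using w3(2) by auto
  then have "A \<noteq> 0" "B \<noteq> 0" using fh by auto
  have "J w = (B / A) *s (c *s J x + d *s J y)"
    using fh \<open>A \<noteq> 0\<close> by (simp add: Jw vec_eq_iff field_simps)
  then have JwK: "J w \<in> K" using K(2) w2(1) by (simp add: vec.subspace_scale)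
  have "w \<noteq> 0" "w \<in> K" using w1 by (auto simp: w_def)
  have span_w: "A = vec.span {J w, w}" if "vec.subspace A" "vec.dim A = 2" "w \<in> A" "J w \<in> A" for A
    using that J0[OF \<open>w \<noteq> 0\<close>] \<open>w \<noteq> 0\<close> by (intro span_pair_eq) auto
  have "vec.span {w} \<in> \<Union> S"
    using S span_in_pg_points[OF \<open>w \<noteq> 0\<close>] by (simp add: spread_def partition_on_def)
  then obtain l' where l': "l' \<in> S" "vec.span {w} \<in> l'" by blast
  then obtain A where A: "l' = pg_flat A" "vec.subspace A" "vec.dim A = 2" using flat lines by blast
  have "w \<in> A" using l'(2) unfolding A(1) pg_flat_def by (auto intro: vec.span_base)
  moreover have "J w \<in> A" using inv[OF A(2,3)] l'(1) \<open>w \<in> A\<close> by (auto simp: A(1))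
  ultimately have "A = K" using span_w A span_w[OF K(2,3) \<open>w \<in> K\<close> JwK] by metis
  then show "k \<in> S" using l'(1) by (simp add: A(1) K(1))
qed

lemma linear_image_pg_flat:
  fixes A :: "'a::field ^ 4 \<Rightarrow> 'a ^ 4"
  assumes A: "Vector_Spaces.linear (*s) (*s) A" "bij A" and U: "vec.subspace U"
  shows "image A ` pg_flat U = pg_flat (A ` U)"
    and "vec.subspace (A ` U)" and "vec.dim (A ` U) = vec.dim U"
proof -
  have inj: "inj A" using A(2) by (rule bij_is_inj)
  have sub: "vec.subspace (A ` V)" if "vec.subspace V" for V
    using vec.linear_subspace_image[OF A(1) that] .
  have dim: "vec.dim (A ` V) = vec.dim V" for V
    using A(1) by (rule vec.dim_image_eq) (use inj in \<open>auto intro: inj_on_subset\<close>)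
  show "vec.subspace (A ` U)" using U by (rule sub)
  show "vec.dim (A ` U) = vec.dim U" by (rule dim)
  show "image A ` pg_flat U = pg_flat (A ` U)"
  proof (intro equalityI subsetI)
    fix P assume "P \<in> image A ` pg_flat U"
    then show "P \<in> pg_flat (A ` U)" by (auto simp: pg_flat_def pg_points_def sub dim)
  next
    fix P assume P: "P \<in> pg_flat (A ` U)"
    define Q where "Q = A -` P"
    have AQ: "A ` Q = P" using bij_is_surj[OF A(2)] by (simp add: Q_def surj_image_vimage_eq)
    have "vec.subspace Q"
      unfolding Q_def using P by (intro vec.linear_subspace_vimage[OF A(1)]) (auto simp: pg_flat_def pg_points_def)
    moreover have "vec.dim Q = 1" using P dim[of Q] by (simp add: AQ pg_flat_def pg_points_def)
    moreover have "Q \<subseteq> U"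
    proof
      fix x assume "x \<in> Q"
      then have "A x \<in> A ` U" using P by (auto simp: Q_def pg_flat_def)
      then show "x \<in> U" by (simp add: inj_image_mem_iff[OF inj])
    qed
    ultimately have "Q \<in> pg_flat U" by (simp add: pg_flat_def pg_points_def)
    then show "P \<in> image A ` pg_flat U" using AQ by blast
  qed
qed

lemma collineation_linear:
  fixes A :: "'a::field ^ 4 \<Rightarrow> 'a ^ 4"
  assumes A: "Vector_Spaces.linear (*s) (*s) A" and B: "Vector_Spaces.linear (*s) (*s) B"
    and AB: "\<And>x. A (B x) = x" and BA: "\<And>x. B (A x) = x"
  shows "collineation (image A)"
proof -
  have bij: "bij A" "bij B" using AB BA by (metis bijI' )+
  have points: "pg_points = pg_flat UNIV" by (simp add: pg_flat_def)
  have surj: "A ` UNIV = UNIV" "B ` UNIV = UNIV" using bij by (auto simp: bij_def)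
  have "image A ` pg_points = pg_points" "image B ` pg_points = pg_points"
    unfolding points using linear_image_pg_flat(1)[OF A bij(1) vec.subspace_UNIV] linear_image_pg_flat(1)[OF B bij(2) vec.subspace_UNIV]
    by (simp_all add: surj)
  moreover have inv: "B ` A ` P = P" "A ` B ` P = P" for P by (simp_all add: image_image AB BA)
  ultimately have "bij_betw (image A) pg_points pg_points"
    by (intro bij_betw_byWitness[of _ "image B"]) auto
  moreover have lines: "image A ` l \<in> pg_lines" if "l \<in> pg_lines" "Vector_Spaces.linear (*s) (*s) A" "bij A" for l and A :: "'a ^ 4 \<Rightarrow> 'a ^ 4"
  proof -
    obtain U where U: "l = pg_flat U" "vec.subspace U" "vec.dim U = 2" using \<open>l \<in> pg_lines\<close> unfolding pg_lines_def by blast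
    then show ?thesis
      using linear_image_pg_flat[OF that(2,3) U(2)] by (auto simp: pg_lines_def)
  qed
  moreover have "image B ` image A ` l = l" for l by (simp add: image_image BA)
  ultimately show ?thesis unfolding collineation_def using A B bij by metis
qed

lemma linear_image_line_through:
  fixes A :: "'a::field ^ 4 \<Rightarrow> 'a ^ 4"
  assumes A: "Vector_Spaces.linear (*s) (*s) A" "bij A"
  shows "image A ` line_through u v = line_through (A u) (A v)"
proof -
  have "A ` vec.span {u, v} = vec.span {A u, A v}"
    using vec.linear_span_image[OF A(1), of "{u, v}"] by simp
  then show ?thesis
    unfolding line_through_def using linear_image_pg_flat(1)[OF A vec.subspace_span] by simp
qed

lemma line_through_eqI:
  fixes u v u' v' :: "'a::field ^ 4"
  assumes "u' = a *s u + b *s v" "v' = c *s u + d *s v" "u = a' *s u' + b' *s v'" "v = c' *s u' + d' *s v'"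
  shows "line_through u' v' = line_through u v"
proof -
  have "u' \<in> vec.span {u, v}" "v' \<in> vec.span {u, v}" unfolding in_span_pair using assms(1,2) by blast+
  moreover have "u \<in> vec.span {u', v'}" "v \<in> vec.span {u', v'}" unfolding in_span_pair using assms(3,4) by blast+
  ultimately have "vec.span {u', v'} = vec.span {u, v}" by (simp add: vec.span_eq)
  then show ?thesis by (simp add: line_through_def)
qed

lemma spread_of_flat_cases:
  assumes "pg_flat U \<in> spread_of g" "vec.subspace U"
  obtains "U = vec.span {vector [0, 0, 0, 1], vector [0, 0, 1, 0]}"
    | x y where "U = vec.span {vector [0, 1, x, y], vector [1, 0, - y, g x y]}"
proof -
  have *: "U = V" if "pg_flat U = pg_flat V" "vec.subspace V" for V :: "('a ^ 4) set"
  proof -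
    have "x \<in> B" if "pg_flat A = pg_flat B" "vec.subspace A" "vec.subspace B" "x \<in> A" for x and A B :: "('a ^ 4) set"
    proof (cases "x = 0")
      case False
      then have "vec.span {x} \<in> pg_flat B" using span_in_pg_flat that by metis
      then show ?thesis unfolding pg_flat_def by (auto intro: vec.span_base)
    qed (use that vec.subspace_0 in auto)
    then show ?thesis using that assms(2) by blast
  qed
  show thesis
    using assms(1) unfolding spread_of_def line_through_def
    by (auto intro: that dest!: *)
qed

section \<open>The linear case and equivalence of spreads\<close>

context char_2
begin

text \<open>\<open>J\<close> acts as an element of the quadratic extension. Its entries are forced
  by \<open>J u = v / k\<close> and \<open>J v = u + (C / k) v\<close> for the generators
  \<open>u\<close>, \<open>v\<close> of each line with parameters \<open>x\<close>,
  \<open>y\<close>.\<close>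

lemma regular_spread_of_linear:
  fixes g :: "'a \<Rightarrow> 'a \<Rightarrow> 'a"
  assumes S: "spread (spread_of g)" and g: "\<And>x y. g x y = k * x + C * y + b"
  shows "regular_spread (spread_of g)"
proof -
  have aniso: "x * (k * x + C * y) + y * y \<noteq> 0" if "(x, y) \<noteq> (0, 0)" for x y
    using spread_of_cond[OF S that] by (simp add: g power2_eq_square two)
  have "k \<noteq> 0" using aniso[of 1 0] by auto
  define J where "J v = (vector [(v$2 + C * v$1) / k, v$1, (v$4 + b * v$1) / k,
      v$3 + (C / k) * (v$4 + b * v$1) + b * ((v$2 + C * v$1) / k)] :: 'a ^ 4)" for v :: "'a ^ 4"
  have lin: "Vector_Spaces.linear (*s) (*s) J"
    unfolding Vector_Spaces.linear_iff
    by (simp add: J_def vec4_eq_iff vec.vector_space_axioms add_divide_distrib algebra_simps)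
  show ?thesis
  proof (rule regular_spreadI[OF S lin])
    fix U :: "('a ^ 4) set"
    assume U: "vec.subspace U" "pg_flat U \<in> spread_of g"
    have J_span: "J ` vec.span {u, v} \<subseteq> vec.span {u, v}"
      if "J u = a *s u + b *s v" "J v = c *s u + d *s v" for u v a b c d
    proof -
      have "J u \<in> vec.span {u, v}" "J v \<in> vec.span {u, v}" unfolding in_span_pair using that by blast+
      then have "vec.span {J u, J v} \<subseteq> vec.span {u, v}" by (intro vec.span_minimal) auto
      then show ?thesis using vec.linear_span_image[OF lin, of "{u, v}"] by simp
    qed
    from U(2,1) show "J ` U \<subseteq> U"
    proof (cases rule: spread_of_flat_cases)
      case 1
      have "J (vector [0, 0, 0, 1]) = (C / k) *s vector [0, 0, 0, 1] + (1 / k) *s vector [0, 0, 1, 0]"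
        "J (vector [0, 0, 1, 0]) = 1 *s vector [0, 0, 0, 1] + 0 *s vector [0, 0, 1, 0]"
        by (simp_all add: J_def vec4_eq_iff)
      then show ?thesis unfolding 1 by (rule J_span)
    next
      case (2 x y)
      have "J (vector [0, 1, x, y]) = 0 *s vector [0, 1, x, y] + (1 / k) *s vector [1, 0, - y, g x y]"
        "J (vector [1, 0, - y, g x y]) = 1 *s vector [0, 1, x, y] + (C / k) *s vector [1, 0, - y, g x y]"
        using \<open>k \<noteq> 0\<close> by (simp_all add: J_def vec4_eq_iff g field_simps)
      then show ?thesis unfolding 2 by (rule J_span)
    qed
  next
    fix v c assume Jv: "J v = c *s v"
    have v: "(v$2 + C * v$1) / k = c * v$1" "v$1 = c * v$2" "(v$4 + b * v$1) / k = c * v$3"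
      "v$3 + (C / k) * (v$4 + b * v$1) + b * ((v$2 + C * v$1) / k) = c * v$4"
      using Jv[THEN arg_cong[of _ _ "\<lambda>w. w$1"]] Jv[THEN arg_cong[of _ _ "\<lambda>w. w$2"]]
        Jv[THEN arg_cong[of _ _ "\<lambda>w. w$3"]] Jv[THEN arg_cong[of _ _ "\<lambda>w. w$4"]]
      by (simp_all only: J_def vector_4_nth vector_smult_component)
    \<comment> \<open>An eigenvalue \<open>c\<close> would be a root of
      \<open>k c\<^sup>2 + C c + 1\<close>, which \<open>aniso\<close> at \<open>(c, 1)\<close>
      forbids.\<close>
    have eigen: "s = 0" if "s + C * (c * s) = k * (c * (c * s))" for s
    proof -
      have "s * (c * (k * c + C * 1) + 1 * 1) = (s + C * (c * s)) + k * (c * (c * s))" by (simp add: algebra_simps)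
      also have "\<dots> = 0" by (simp add: that)
      finally have "s * (c * (k * c + C * 1) + 1 * 1) = 0" .
      with aniso[of c 1] show ?thesis by simp
    qed
    have "v$2 = 0" using v(1,2) \<open>k \<noteq> 0\<close> by (intro eigen) (simp add: field_simps)
    then have "v$1 = 0" using v(2) by simp
    have v4: "v$4 = k * (c * v$3)" using v(3) \<open>k \<noteq> 0\<close> \<open>v$1 = 0\<close> by (simp add: field_simps)
    have "v$3 = 0"
      using v(4) \<open>k \<noteq> 0\<close> \<open>v$1 = 0\<close> \<open>v$2 = 0\<close> by (intro eigen) (simp add: v4 ac_simps)
    then show "v = 0" using v4 \<open>v$1 = 0\<close> \<open>v$2 = 0\<close> by (simp add: vec4_eq_iff)
  qed
qed

text \<open>In terms of the symmetric matrices \<open>((x, y), (y, g))\<close> of the lines, the collineation is the congruence by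
  \<open>((1/c, 0), (rc, c))\<close> followed by a translation.\<close>

lemma equivalent_spread_of:
  fixes g g' :: "'a \<Rightarrow> 'a \<Rightarrow> 'a"
  assumes c: "c \<noteq> 0" and g: "\<And>x y. g x y = c\<^sup>2 * (g' (c\<^sup>2 * x) (y + r * (c\<^sup>2 * x)) + r\<^sup>2 * (c\<^sup>2 * x) + b)"
  shows "equivalent_sets (spread_of g) (spread_of g')"
proof -
  define A where "A v = (vector [v$1 / c, c * (v$2 + r * v$1), v$3 / c, r * c * v$3 + c * v$4 + c * b * v$1] :: 'a ^ 4)" for v :: "'a ^ 4"
  define B where "B v = (vector [c * v$1, v$2 / c + r * c * v$1, c * v$3, v$4 / c + r * c * v$3 + b * c * v$1] :: 'a ^ 4)" for v :: "'a ^ 4"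
  have lin: "Vector_Spaces.linear (*s) (*s) A" "Vector_Spaces.linear (*s) (*s) B"
    unfolding Vector_Spaces.linear_iff
    by (simp_all add: A_def B_def vec4_eq_iff vec.vector_space_axioms add_divide_distrib algebra_simps)
  have AB: "A (B x) = x" and BA: "B (A x) = x" for x
    using c by (simp_all add: A_def B_def vec4_eq_iff field_simps)
  have bij: "bij A" using AB BA by (metis bijI')
  define L L' where "L x y = line_through (vector [0, 1, x, y]) (vector [1, 0, - y, g x y])"
    and "L' x y = line_through (vector [0, 1, x, y]) (vector [1, 0, - y, g' x y])" for x y
  define l0 :: "('a ^ 4) set set" where "l0 = line_through (vector [0, 0, 0, 1]) (vector [0, 0, 1, 0])"
  have L: "image A ` L' (c\<^sup>2 * x) (y + r * (c\<^sup>2 * x)) = L x y" for x y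
    unfolding L_def L'_def linear_image_line_through[OF lin(1) bij]
    by (rule line_through_eqI[where a = c and b = 0 and c = "c * r" and d = "1 / c" and a' = "1 / c" and b' = 0 and c' = "- c * r" and d' = c])
      (use c in \<open>simp_all add: A_def vec4_eq_iff g field_simps power2_eq_square\<close>)
  have l0: "image A ` l0 = l0"
    unfolding l0_def linear_image_line_through[OF lin(1) bij]
    by (rule line_through_eqI[where a = c and b = 0 and c = "r * c" and d = "1 / c" and a' = "1 / c" and b' = 0 and c' = "- r * c" and d' = c])
      (use c in \<open>simp_all add: A_def vec4_eq_iff field_simps\<close>)
  have "spread_of g = {l0} \<union> {L x y |x y. True}" "spread_of g' = {l0} \<union> {L' x y |x y. True}"
    by (simp_all add: spread_of_def l0_def L_def L'_def)
  moreover have "(\<lambda>l. image A ` l) ` {L' x y |x y. True} = {L x y |x y. True}"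
  proof (intro equalityI subsetI)
    fix l assume "l \<in> (\<lambda>l. image A ` l) ` {L' x y |x y. True}"
    then obtain X Y where "l = image A ` L' X Y" by auto
    moreover have "L' X Y = L' (c\<^sup>2 * (X / c\<^sup>2)) ((Y + r * X) + r * (c\<^sup>2 * (X / c\<^sup>2)))"
      using c by (simp add: add.assoc)
    ultimately have "l = L (X / c\<^sup>2) (Y + r * X)" by (simp only: L)
    then show "l \<in> {L x y |x y. True}" by blast
  next
    fix l assume "l \<in> {L x y |x y. True}"
    then show "l \<in> (\<lambda>l. image A ` l) ` {L' x y |x y. True}" using L by (auto simp: image_iff) metis
  qed
  ultimately have "spread_of g = (\<lambda>l. image A ` l) ` spread_of g'" by (simp only: image_Un image_insert image_empty l0)
  then show ?thesis unfolding equivalent_sets_def using collineation_linear[OF lin AB BA] by blast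
qed

end

section \<open>From the spread to the slope condition\<close>

context field_2e
begin

text \<open>For fixed \<open>u \<noteq> 0\<close> the additive map \<open>v \<mapsto> v\<^sup>2 + C u \<sigma>(v)\<close> misses the value \<open>u (f(u) - f(0))\<close>, so it has a
  nontrivial kernel. Hence \<open>v \<mapsto> v\<^sup>2 / \<sigma>(v)\<close> permutes the nonzero elements.\<close>

lemma spread_of_twist:
  fixes g :: "'a \<Rightarrow> 'a \<Rightarrow> 'a"
  assumes S: "spread (spread_of g)" and g: "\<And>x y. g x y = f x + C * y ^ 2 ^ Suc t"
  shows "C \<noteq> 0" and "\<And>x::'a. x ^ 2 ^ t = x \<Longrightarrow> x = 0 \<or> x = 1"
proof -
  define \<phi> where "\<phi> u v = v\<^sup>2 + C * u * v ^ 2 ^ Suc t" for u v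
  have phi_add: "\<phi> u (v + w) = \<phi> u v + \<phi> u w" for u v w
    by (simp add: \<phi>_def add_square frob_add distrib_left ac_simps del: power_Suc)
  have kernel: "\<exists>v. v \<noteq> 0 \<and> v\<^sup>2 = C * u * v ^ 2 ^ Suc t" if "u \<noteq> 0" for u
  proof (rule ccontr)
    assume no: "\<not> ?thesis"
    have "inj (\<phi> u)"
    proof (rule injI)
      fix v w assume "\<phi> u v = \<phi> u w"
      then have "\<phi> u (v + w) = 0" by (simp add: phi_add)
      then have "(v + w)\<^sup>2 = C * u * (v + w) ^ 2 ^ Suc t" by (simp only: \<phi>_def add_eq_0)
      with no show "v = w" by (metis add_eq_0)
    qed
    then have "surj (\<phi> u)" by (rule finite_UNIV_inj_surj[OF finite])
    then obtain v where "\<phi> u v = u * (f u + f 0)" by (metis surjD)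
    then have "u * (f u + C * v ^ 2 ^ Suc t + f 0) + v\<^sup>2 = 0"
      by (simp add: \<phi>_def distrib_left ac_simps del: power_Suc)
    moreover have "(u - 0) * (g u v - g 0 0) + (v - 0)\<^sup>2 \<noteq> 0" by (rule spread_of_cond[OF S]) (use that in simp)
    ultimately show False by (simp add: g power_0_left del: power_Suc)
  qed
  show C: "C \<noteq> 0" using kernel[of 1] by auto
  \<comment> \<open>Every nonzero \<open>u\<close> is \<open>\<psi> v\<close> for its kernel vector
    \<open>v\<close>. Surjectivity on a finite set gives injectivity, whereas a nonzero fixed point
    of the twist has the same image as \<open>1\<close>.\<close>
  define \<psi> where "\<psi> v = v\<^sup>2 / (C * v ^ 2 ^ Suc t)" for v
  have "UNIV - {0} \<subseteq> \<psi> ` (UNIV - {0})"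
  proof
    fix u :: 'a assume "u \<in> UNIV - {0}"
    then obtain v where v: "v \<noteq> 0" "v\<^sup>2 = C * u * v ^ 2 ^ Suc t" using kernel by blast
    then have "u = \<psi> v" using C by (simp add: \<psi>_def field_simps del: power_Suc)
    with v(1) show "u \<in> \<psi> ` (UNIV - {0})" by blast
  qed
  then have inj: "inj_on \<psi> (UNIV - {0})" by (intro finite_surj_inj) auto
  show "x = 0 \<or> x = 1" if "x ^ 2 ^ t = x" for x :: 'a
  proof (cases "x = 0")
    case False
    have "x ^ 2 ^ Suc t = x ^ (2 ^ t * 2)" by (simp only: power_Suc mult.commute)
    also have "\<dots> = x\<^sup>2" by (simp only: power_mult that)
    finally have "x ^ 2 ^ Suc t = x\<^sup>2" .
    then have "\<psi> x = \<psi> 1" using False by (simp add: \<psi>_def del: power_Suc)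
    with inj False show ?thesis by (simp add: inj_on_def)
  qed simp
qed

end

context frob_twist
begin

text \<open>If the trace were not \<open>1\<close>, \<open>T d * D = y + T y\<close> would have a
  solution \<open>y\<close>, and \<open>v\<close> with \<open>v\<^sup>2 = y / d\<close> would give
  two lines with a common point.\<close>

lemma spread_of_slope_cond:
  fixes g :: "'a \<Rightarrow> 'a \<Rightarrow> 'a"
  assumes S: "spread (spread_of g)" and g: "\<And>x y. g x y = f x + C * S y" and C: "C \<noteq> 0"
  shows "slope_cond 1 (\<lambda>X. f (X / C) / C)"
  unfolding slope_cond_def
proof (intro allI impI)
  fix d X :: 'a assume d: "d \<noteq> 0"
  define U where "U = T d / d"
  have U: "U \<noteq> 0" "T d = U * d" using d by (auto simp: U_def)
  define D where "D = dd U (\<lambda>X. f (X / C) / C) X"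
  have fD: "f ((X + U) / C) + f (X / C) = C * D"
    using C by (simp add: D_def dd_def field_simps)
  have "T d * D \<notin> range (\<lambda>y. y + y ^ 2 ^ t)"
  proof
    assume "T d * D \<in> range (\<lambda>y. y + y ^ 2 ^ t)"
    then obtain y where y: "T d * D = y + T y" by (auto simp: T_def)
    obtain v where v: "v\<^sup>2 = y / d" using frob_surj[of 1 "y / d"] by auto
    have Sv: "S v = T y / T d" by (metis S_def T_simps(5) T_simps(8) v)
    have "(X + U) / C + X / C = U / C" using C by (simp add: add_divide_distrib ac_simps)
    moreover have "((X + U) / C, v) \<noteq> (X / C, 0)" using C U by simp
    from spread_of_cond[OF S this] have
      "((X + U) / C + X / C) * ((f ((X + U) / C) + f (X / C)) + C * S v) + v\<^sup>2 \<noteq> 0"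
      by (simp add: g ac_simps)
    ultimately have "U / C * (C * D + C * S v) + y / d \<noteq> 0" by (simp only: fD v not_False_eq_True)
    moreover have "U / C * (C * D + C * S v) = U * (D + S v)" using C by (simp add: field_simps)
    moreover have "U * (D + S v) = y / d"
    proof -
      have "d * (U * (D + S v)) = T d * D + T d * S v" by (simp add: U(2) algebra_simps)
      also have "\<dots> = y" using d by (simp add: y Sv add.assoc)
      finally show ?thesis using d by (simp add: field_simps)
    qed
    ultimately show False by simp
  qed
  then have "Tr (T d * D) = 1" by (rule Tr_eq_1_if_not_in_range[OF fixed_point, rotated])
  then show "Tr (T d * dd (T d / d) (\<lambda>X. f (X / C) / C) X) = 1" by (simp only: D_def U_def)
qed

end

theorem theorem4:
  fixes h1 :: "'a::{field,finite} poly"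
    and C :: 'a
    and \<sigma> :: "'a \<Rightarrow> 'a"
    and g :: "'a \<Rightarrow> 'a \<Rightarrow> 'a"
  assumes "even CARD('a)"
    and "field_automorphism \<sigma>"
    and "\<And>x y. g x y = poly h1 x + C * \<sigma> y"
    and "spread (spread_of g)"
  shows "regular_spread (spread_of g) \<or> tits_lueneburg_spread (spread_of g)"
proof -
  obtain e where "field_2e TYPE('a) e" using even_card_field_2e[OF assms(1)] .
  then interpret field_2e "TYPE('a)" e .
  obtain s where s: "s < e" "\<And>x. \<sigma> x = x ^ 2 ^ s" using field_automorphism_frob[OF assms(2)] by blast
  \<comment> \<open>\<open>t\<close> is \<open>s - 1\<close> modulo \<open>e\<close>, so that
    \<sigma> is the square of \<tau>; adding \<open>e\<close> covers \<open>s = 0\<close>.\<close>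
  define t where "t = (s + e - 1) mod e"
  have "Suc t mod e = s"
    unfolding t_def using s(1) by (simp add: mod_Suc_eq)
  then have sigma: "\<sigma> x = x ^ 2 ^ Suc t" for x using s(2) frob_mod[of x "Suc t"] by simp
  have g: "g x y = poly h1 x + C * y ^ 2 ^ Suc t" for x y using assms(3) sigma by simp
  note twist = spread_of_twist[OF assms(4) g]
  interpret frob_twist "TYPE('a)" e t
    by unfold_locales (use twist(2) e_pos in \<open>auto simp: t_def\<close>)
  have C: "C \<noteq> 0" by (rule twist(1))
  have gS: "g x y = poly h1 x + C * S y" for x y using g by (simp only: S_power)
  \<comment> \<open>\<open>p\<close> is the \<open>H\<close> of the overview.\<close>
  define p where "p = smult (1 / C) (h1 \<circ>\<^sub>p [:0, 1 / C:])"
  have poly_p: "poly p = (\<lambda>X. poly h1 (X / C) / C)" by (auto simp: p_def poly_pcompose)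
  then have h1: "poly h1 x = C * poly p (C * x)" for x using C by simp
  have "slope_cond 1 (poly p)" unfolding poly_p by (rule spread_of_slope_cond[OF assms(4) gS C])
  then consider k b where "t + 1 = e" "\<And>x. poly p x = k * x + b"
    | a b where "e = 2 * t + 1" "\<And>x. poly p x = x * S x + a * x + T a * S x + b"
    using slope_cond_classification by blast
  then show ?thesis
  proof cases
    case 1
    have S: "S y = y" for y using 1(1) by (simp add: S_power frob_e)
    have "g x y = (C * k * C) * x + C * y + C * b" for x y
      by (simp add: gS h1 1(2) S algebra_simps)
    then have "regular_spread (spread_of g)" by (rule regular_spread_of_linear[OF assms(4)])
    then show ?thesis by simp
  next
    case 2
    obtain c where c: "c\<^sup>2 = C" using frob_surj[of 1 C] by auto
    \<comment> \<open>The shear \<open>y \<mapsto> y + r C x\<close> contributes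
      \<open>S r * S (C * x)\<close>. Since \<open>S r = T a\<close>, it absorbs the term with
      \<open>T a\<close>, while \<open>r\<^sup>2\<close> accounts for the one with
      \<open>a\<close>.\<close>
    obtain r where r: "r\<^sup>2 = a" using frob_surj[of 1 a] by auto
    have "c \<noteq> 0" using c C by auto
    define g' where "g' x y = x ^ (2 ^ (t + 1) + 1) + y ^ 2 ^ (t + 1)" for x y :: 'a
    have g': "g' x y = x * S x + S y" for x y by (simp add: g'_def S_power mult.commute)
    have Ta: "T a = S r" unfolding S_def r[symmetric] by simp
    have "g x y = c\<^sup>2 * (g' (c\<^sup>2 * x) (y + r * (c\<^sup>2 * x)) + r\<^sup>2 * (c\<^sup>2 * x) + b)" for x y
      unfolding c r gS h1 2(2) g' Ta S_simps by (simp add: algebra_simps)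
    from equivalent_spread_of[of c g g' r b, OF \<open>c \<noteq> 0\<close> this] have "equivalent_sets (spread_of g) (spread_of g')" .
    then have "tits_lueneburg_spread (spread_of g)"
      unfolding tits_lueneburg_spread_def g'_def[abs_def] using assms(4) card 2(1) by blast
    then show ?thesis by simp
  qed
qed

end
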